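(* Let $\phi$ be a Ma-Minda function such that $\min_{|z|=r}|\phi(z)|=\phi(-r)$ and $\max_{|z|=r}|\phi(z)|=\phi(r)$ for all $0<r<1$. Define $$R(r):=\int_0^r \frac{M_\phi(t)}{1-t^2}\,dt,\qquad L(r):=\int_0^r\frac{\phi(-t)}{1+t^2}\,dt ,$$ where $M_\phi$ is the majorant series of $\phi$. Let $f(z)=z+\sum_{n=2}^\infty a_nz^n\in\mathcal{K}_s(\phi)$. Then $$|z|+\sum_{n=2}^\infty |a_n||z|^n\le d(f(0),\partial f(\mathbb{D}))$$ for $|z|=r\le R_f$, where $R_f=\min\{1/3,r_f\}$ and $r_f$ is the smallest positive root of $R(r)=L(1)$ in $(0,1)$.
   Context: $\mathbb{D}=\{z\in\mathbb{C}:|z|<1\}$ and $\mathcal{A}$ is the class of analytic functions $f$ in $\mathbb{D}$ of the form $f(z)=z+\sum_{n\ge2}a_nz^n$. $d$ is Euclidean distance, $d(f(0),\partial f(\mathbb{D}))$ being the distance from $f(0)$ to the boundary of $f(\mathbb{D})$. For $f(z)=\sum_{n\ge0}a_nz^n$ analytic in $\mathbb{D}$, the majorant series is $M_f(r)=\sum_{n\ge0}|a_n|r^n$, $0\le r<1$. For analytic $f,g$ in $\mathbb{D}$, $f\prec g$ ($f$ is subordinate to $g$) means $f=g\circ\omega$ for some analytic $\omega:\mathbb{D}\to\mathbb{D}$ with $\omega(0)=0$. A Ma-Minda function is an analytic univalent function $\phi:\mathbb{D}\to\mathbb{C}$ such that $\phi(\mathbb{D})$ lies in the right half-plane $\{\mathrm{Re}\,w>0\}$,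 is symmetric with respect to the real axis and starlike with respect to $\phi(0)=1$, and $\phi'(0)>0$. $\mathcal{S}^*(1/2)$ is the class of $g\in\mathcal{A}$ with $\mathrm{Re}(zg'(z)/g(z))>1/2$ in $\mathbb{D}$. $\mathcal{K}_s(\phi)$ is the class of $f\in\mathcal{A}$ such that $-\dfrac{z^2f'(z)}{g(z)g(-z)}\prec\phi(z)$ in $\mathbb{D}$ for some $g\in\mathcal{S}^*(1/2)$. *)

theory Defs
  imports "HOL-Complex_Analysis.Complex_Analysis"
begin

abbreviation unit_disc :: "complex set" where
  "unit_disc \<equiv> ball 0 1"

abbreviation taylor_coeff :: "(complex \<Rightarrow> complex) \<Rightarrow> nat \<Rightarrow> complex" where
  "taylor_coeff f n \<equiv> fps_nth (fps_expansion f 0) n"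

definition majorant :: "(complex \<Rightarrow> complex) \<Rightarrow> real \<Rightarrow> real" where
  "majorant f r = (\<Sum>n. cmod (taylor_coeff f n) * r ^ n)"

definition class_A :: "(complex \<Rightarrow> complex) set" where
  "class_A = {f. f holomorphic_on unit_disc \<and> taylor_coeff f 0 = 0 \<and> taylor_coeff f 1 = 1}"

definition subordinate :: "(complex \<Rightarrow> complex) \<Rightarrow> (complex \<Rightarrow> complex) \<Rightarrow> bool"
    (infix "\<prec>\<^sub>s" 50) where
  "f \<prec>\<^sub>s g \<longleftrightarrow>
     (\<exists>\<omega>. \<omega> holomorphic_on unit_disc \<and> \<omega> \<in> unit_disc \<rightarrow> unit_disc \<and> \<omega> 0 = 0 \<and>
          (\<forall>z\<in>unit_disc. f z = g (\<omega> z)))"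

definition ma_minda :: "(complex \<Rightarrow> complex) \<Rightarrow> bool" where
  "ma_minda \<phi> \<longleftrightarrow>
     \<phi> holomorphic_on unit_disc \<and> inj_on \<phi> unit_disc \<and>
     \<phi> ` unit_disc \<subseteq> {w. 0 < Re w} \<and>
     cnj ` (\<phi> ` unit_disc) = \<phi> ` unit_disc \<and>
     \<phi> 0 = 1 \<and> (\<forall>w\<in>\<phi> ` unit_disc. closed_segment (\<phi> 0) w \<subseteq> \<phi> ` unit_disc) \<and>
     deriv \<phi> 0 \<in> \<real> \<and> 0 < Re (deriv \<phi> 0)"

text \<open>
  The quotients below have a removable singularity at the origin, where they take the value 1
  after analytic continuation; since \<open>0 / 0 = 0\<close> in HOL, this continuation has to be made explicit
  by \<^const>\<open>remove_sings\<close>. At a pole \<^const>\<open>remove_sings\<close> yields 0, so the condition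
  in \<open>starlike_half\<close> fails if \<open>g\<close> has a zero in the punctured disc.
\<close>

definition starlike_half :: "(complex \<Rightarrow> complex) set" where
  "starlike_half =
     {g \<in> class_A. \<forall>z\<in>unit_disc. Re (remove_sings (\<lambda>z. z * deriv g z / g z) z) > 1 / 2}"

definition class_Ks :: "(complex \<Rightarrow> complex) \<Rightarrow> (complex \<Rightarrow> complex) set" where
  "class_Ks \<phi> =
     {f \<in> class_A. \<exists>g\<in>starlike_half.
        remove_sings (\<lambda>z. - (z\<^sup>2 * deriv f z / (g z * g (- z)))) \<prec>\<^sub>s \<phi>}"

definition R_int :: "(complex \<Rightarrow> complex) \<Rightarrow> real \<Rightarrow> real" where
  "R_int \<phi> r = integral {0..r} (\<lambda>t. majorant \<phi> t / (1 - t\<^sup>2))"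

text \<open>
  A Ma-Minda function is real on the real axis, so \<open>Re\<close> only changes the type here. For \<open>r = 1\<close>
  the integrand has no meaning at the single point \<open>t = 1\<close>, which does not affect the integral.
\<close>

definition L_int :: "(complex \<Rightarrow> complex) \<Rightarrow> real \<Rightarrow> real" where
  "L_int \<phi> r = integral {0..r} (\<lambda>t. Re (\<phi> (- of_real t)) / (1 + t\<^sup>2))"

definition smallest_root :: "(complex \<Rightarrow> complex) \<Rightarrow> real \<Rightarrow> bool" where
  "smallest_root \<phi> \<rho> \<longleftrightarrow>
     \<rho> \<in> {0<..<1} \<and> R_int \<phi> \<rho> = L_int \<phi> 1 \<and>
     (\<forall>s\<in>{0<..<1}. R_int \<phi> s = L_int \<phi> 1 \<longrightarrow> \<rho> \<le> s)"

end

theory Submission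
  imports Defs
begin

text \<open>
  Write \<open>G(z) = - g(z) g(- z) / z\<close> and \<open>E(z) = G(z) / z\<close>. The function \<open>E\<close> is even, has no zeros,
  satisfies \<open>E(0) = 1\<close> and \<open>Re (1 + z E'(z) / E(z)) > 0\<close>, i.e. \<open>G\<close> is an odd starlike function, and
  membership in \<open>K_s(\<phi>)\<close> says that \<open>f' = E \<cdot> (\<phi> \<circ> \<omega>)\<close> for a Schwarz function \<open>\<omega>\<close>
  (\<open>class_Ks_factorization\<close>). The theorem compares both sides of its inequality with \<open>L(1)\<close>.

  All that is needed about \<open>E\<close> follows from \<open>\<bar>u\<bar> < 1\<close> for \<open>u = 1 - 1 / E\<close>, which is proved by a version
  of Jack's lemma: at a first point \<open>z\<^sub>0\<close> where \<open>\<bar>u\<bar>\<close> reaches 1, \<open>z\<^sub>0 u'(z\<^sub>0) / u(z\<^sub>0)\<close> is real and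
  at least 2, because \<open>u\<close> has a double zero at the origin; this makes \<open>Re (1 + z\<^sub>0 E'(z\<^sub>0) / E(z\<^sub>0))\<close>
  nonpositive. From \<open>\<bar>u\<bar> < 1\<close> one gets \<open>Re E > 1/2\<close>, then \<open>\<bar>E(z)\<bar> \<ge> 1 / (1 + \<bar>z\<bar>\<^sup>2)\<close> by the Schwarz
  lemma for double zeros, and coefficients of modulus at most 1 by Caratheodory's bound.

  Upper bound. The majorant series of \<open>E\<close> is at most \<open>1 / (1 - t\<^sup>2)\<close>, since the odd coefficients
  vanish. For \<open>t \<le> 1/3\<close> Bohr's theorem, applied to the powers of \<open>\<omega>(z) / z\<close>, shows that the majorant
  series of \<open>\<phi> \<circ> \<omega>\<close> is at most \<open>M\<^sub>\<phi>(t)\<close> (\<open>majorant_subordinate_partial_sum\<close>). Multiplying the two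
  and integrating from 0 to \<open>r\<close> bounds the majorant series of \<open>f\<close> by \<open>R(r)\<close>, which is at most
  \<open>R(r\<^sub>f) = L(1)\<close>.

  Lower bound. As \<open>\<bar>\<phi>\<bar>\<close> attains its minimum over \<open>\<bar>z\<bar> \<le> r\<close> at \<open>- r\<close>, \<open>\<bar>f'(z)\<bar>\<close> is at least
  \<open>\<phi>(- \<bar>z\<bar>) / (1 + \<bar>z\<bar>\<^sup>2)\<close>, the integrand of \<open>L\<close>. Pulling back the segment from \<open>f(0)\<close> to a nearest
  boundary point and integrating \<open>\<bar>f'\<bar>\<close> along the preimage, a curve from the origin to the unit circle,
  shows that the segment has length at least \<open>L(1)\<close> (\<open>covering_radius\<close>). This requires that \<open>f\<close> is univalent: then the preimage exists, and by
  Liouville's theorem the boundary is not empty. The function \<open>f\<close> is close-to-convex: a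
  primitive \<open>K\<close> of \<open>E\<close> is univalent with convex image (\<open>convex_V\<close>), and \<open>f \<circ> K\<^sup>-\<^sup>1\<close> has the
  derivative \<open>\<phi> \<circ> \<omega> \<circ> K\<^sup>-\<^sup>1\<close> with positive real part, so it is injective.
\<close>

section \<open>Coefficient bounds and majorant series of subordinate functions\<close>

lemma taylor_coeff_eqI:
  assumes "f has_fps_expansion F"
  shows "taylor_coeff f n = fps_nth F n"
  using fps_expansion_eqI[OF assms] by simp

text \<open>
  On a circle of radius \<open>r\<close> the \<open>n\<close>-th Fourier coefficient of \<open>p\<close> is \<open>p\<^sub>n r\<^sup>n\<close>, that of the conjugate
  of \<open>p\<close> is 0. Their sum is the Fourier coefficient of the nonnegative function \<open>2 Re p\<close>, hence
  bounded by its mean value \<open>2 Re (p 0)\<close>. Finally \<open>r\<close> tends to 1.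
\<close>

lemma caratheodory_coeff_bound:
  fixes p :: "complex \<Rightarrow> complex"
  assumes hol: "p holomorphic_on ball 0 1"
    and pos: "\<And>z. z \<in> ball 0 1 \<Longrightarrow> 0 \<le> Re (p z)" and n: "n \<ge> 1"
  shows "cmod (taylor_coeff p n) \<le> 2 * Re (p 0)"
proof -
  have key: "cmod (taylor_coeff p n) * r ^ n \<le> 2 * Re (p 0)" if r: "0 < r" "r < 1" for r :: real
  proof -
    define u where "u x = of_real r * exp (2 * of_real pi * \<i> * of_real x)" for x :: real
    have normu: "cmod (u x) = r" for x
      using r by (simp add: u_def norm_mult)
    have cp: "circlepath 0 r x = u x" for x
      by (simp add: u_def circlepath)
    have vd: "vector_derivative (circlepath 0 r) (at x within {0..1}) = 2 * pi * \<i> * u x" if "x \<in> {0..1}" for x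
      using that by (simp add: vector_derivative_circlepath01 u_def mult_ac)
    have unz: "u x \<noteq> 0" for x using normu[of x] r by auto
    have uball: "u x \<in> ball 0 1" for x using normu[of x] r by simp
    have sub: "cball 0 r \<subseteq> ball (0::complex) 1" using r by auto
    have cont: "continuous_on (cball 0 r) p"
      using hol sub holomorphic_on_imp_continuous_on holomorphic_on_subset by blast
    have holr: "p holomorphic_on ball 0 r"
      using hol by (rule holomorphic_on_subset) (use sub in force)
    \<comment> \<open>Cauchy's formula, with \<open>du = 2 \<pi> \<i> u dx\<close> on the circle\<close>
    have I1: "((\<lambda>x. p (u x) / u x ^ k) has_integral taylor_coeff p k) {0..1}" for k
    proof -
      have "((\<lambda>u. p u / (u - 0) ^ Suc k) has_contour_integral 2 * pi * \<i> / fact k * (deriv ^^ k) p 0) (circlepath 0 r)"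
        by (rule Cauchy_has_contour_integral_higher_derivative_circlepath[OF cont holr]) (use r in auto)
      hence "((\<lambda>x. p (u x) / u x ^ Suc k * (2 * pi * \<i> * u x)) has_integral 2 * pi * \<i> / fact k * (deriv ^^ k) p 0) {0..1}"
        unfolding has_contour_integral_def
        by (rule has_integral_eq[rotated])
          (simp add: vd cp)
      hence "((\<lambda>x. inverse (2 * pi * \<i>) * (p (u x) / u x ^ Suc k * (2 * pi * \<i> * u x)))
         has_integral inverse (2 * pi * \<i>) * (2 * pi * \<i> / fact k * (deriv ^^ k) p 0)) {0..1}"
        by (rule has_integral_mult_right)
      thus ?thesis
        by (rule has_integral_eq_rhs[OF has_integral_eq[rotated]])
          (use unz in \<open>auto simp: fps_expansion_def field_simps\<close>)
    qed
    \<comment> \<open>conjugate of Cauchy's theorem for \<open>p u\<^sup>n\<^sup>-\<^sup>1\<close>, as the conjugate of \<open>u\<close> is \<open>r\<^sup>2 / u\<close>\<close>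
    have I2: "((\<lambda>x. cnj (p (u x)) / u x ^ n) has_integral 0) {0..1}"
    proof -
      have "((\<lambda>u. p u * u ^ (n - 1)) has_contour_integral 0) (circlepath 0 r)"
        by (rule Cauchy_theorem_convex_simple[of _ "ball 0 1"])
          (use r sub in \<open>auto intro!: holomorphic_intros hol\<close>)
      hence "((\<lambda>x. p (u x) * u x ^ (n - 1) * (2 * pi * \<i> * u x)) has_integral 0) {0..1}"
        unfolding has_contour_integral_def
        by (rule has_integral_eq[rotated])
          (simp add: vd cp)
      hence "((\<lambda>x. inverse (2 * pi * \<i>) * (p (u x) * u x ^ (n - 1) * (2 * pi * \<i> * u x)))
         has_integral inverse (2 * pi * \<i>) * 0) {0..1}"
        by (rule has_integral_mult_right)
      hence "((\<lambda>x. p (u x) * u x ^ n) has_integral 0) {0..1}"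
        by (rule has_integral_eq_rhs[OF has_integral_eq[rotated]])
          (use n in \<open>simp_all add: power_eq_if[of _ n] mult_ac\<close>)
      hence "((\<lambda>x. cnj (p (u x) * u x ^ n)) has_integral cnj 0) {0..1}"
        using has_integral_cnj[of "\<lambda>x. p (u x) * u x ^ n" 0 "{0..1}"] by (simp only: o_def)
      hence "((\<lambda>x. inverse (of_real r ^ (2*n)) * cnj (p (u x) * u x ^ n)) has_integral inverse (of_real r ^ (2*n)) * cnj 0) {0..1}"
        by (rule has_integral_mult_right)
      moreover have "inverse (of_real r ^ (2*n)) * cnj (p (u x) * u x ^ n) = cnj (p (u x)) / u x ^ n" for x
      proof -
        have "u x * cnj (u x) = of_real r ^ 2"
          using complex_norm_square[of "u x"] by (simp add: normu)
        hence "of_real r ^ (2*n) = u x ^ n * cnj (u x) ^ n"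
          by (simp add: power_mult power_mult_distrib[symmetric])
        thus ?thesis using unz[of x] r by (simp add: field_simps)
      qed
      ultimately show ?thesis by simp
    qed
    have I3: "((\<lambda>x. of_real (2 * Re (p (u x))) / u x ^ n) has_integral taylor_coeff p n) {0..1}"
      using has_integral_add[OF I1[of n] I2]
      by (rule has_integral_eq_rhs[OF has_integral_eq[rotated]])
        (auto simp: complex_add_cnj add_divide_distrib[symmetric])
    have "((\<lambda>x. Re (p (u x))) has_integral Re (taylor_coeff p 0)) {0..1}"
      using has_integral_linear[OF I1[of 0] bounded_linear_Re] by (simp add: o_def)
    hence "((\<lambda>x. 2 / r ^ n * Re (p (u x))) has_integral 2 / r ^ n * Re (taylor_coeff p 0)) {0..1}"
      by (rule has_integral_mult_right)
    hence I4: "((\<lambda>x. 2 * Re (p (u x)) / r ^ n) has_integral 2 * Re (p 0) / r ^ n) {0..1}"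
      by (simp add: fps_expansion_def)
    have "norm (integral {0..1} (\<lambda>x. of_real (2 * Re (p (u x))) / u x ^ n))
        \<le> integral {0..1} (\<lambda>x. 2 * Re (p (u x)) / r ^ n)"
      by (rule integral_norm_bound_integral)
        (use I3 I4 pos[OF uball] in \<open>auto simp: has_integral_integrable norm_divide norm_power norm_mult normu\<close>)
    hence "cmod (taylor_coeff p n) \<le> 2 * Re (p 0) / r ^ n"
      unfolding integral_unique[OF I3] integral_unique[OF I4] .
    thus ?thesis using r by (simp add: field_simps)
  qed
  have "((\<lambda>r. cmod (taylor_coeff p n) * r ^ n) \<longlongrightarrow> cmod (taylor_coeff p n) * 1 ^ n) (at_left (1::real))"
    by (intro tendsto_intros)
  moreover have "eventually (\<lambda>r. cmod (taylor_coeff p n) * r ^ n \<le> 2 * Re (p 0)) (at_left (1::real))"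
    using eventually_at_left_real[of 0 "1::real", OF zero_less_one] by eventually_elim (use key in auto)
  ultimately show ?thesis
    by (intro tendsto_upperbound[of "\<lambda>r. cmod (taylor_coeff p n) * r ^ n" _ "at_left (1::real)"]) auto
qed

text \<open>
  For \<open>\<bar>c\<bar> = 1\<close> the function \<open>1 - c b\<close> has nonnegative real part; with \<open>c b(0) = \<bar>b(0)\<bar>\<close> the bound of
  Caratheodory becomes the one stated.
\<close>

lemma bounded_coeff_bound:
  fixes b :: "complex \<Rightarrow> complex"
  assumes hol: "b holomorphic_on ball 0 1"
    and bd: "\<And>z. z \<in> ball 0 1 \<Longrightarrow> cmod (b z) \<le> 1" and n: "n \<ge> 1"
  shows "cmod (taylor_coeff b n) \<le> 2 * (1 - cmod (b 0))"
proof -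
  obtain c where c: "cmod c = 1" "c * b 0 = of_real (cmod (b 0))"
  proof (cases "b 0 = 0")
    case False
    thus ?thesis
      by (intro that[of "cnj (b 0) / cmod (b 0)"])
        (auto simp: norm_divide complex_norm_square[symmetric] power2_eq_square mult.commute[of "cnj _"])
  qed (use that[of 1] in auto)
  define p where "p z = 1 - c * b z" for z
  have fb: "b has_fps_expansion fps_expansion b 0"
    using hol by (intro has_fps_expansion_fps_expansion) auto
  have "p has_fps_expansion 1 - fps_const c * fps_expansion b 0"
    unfolding p_def by (intro fps_expansion_intros fb)
  hence "taylor_coeff p n = - c * taylor_coeff b n"
    using n taylor_coeff_eqI by fastforce
  hence "cmod (taylor_coeff b n) = cmod (taylor_coeff p n)"
    using c by (simp add: norm_mult)
  also have "\<dots> \<le> 2 * Re (p 0)"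
  proof (rule caratheodory_coeff_bound)
    fix z :: complex assume "z \<in> ball 0 1"
    have "Re (c * b z) \<le> cmod (c * b z)" by (rule complex_Re_le_cmod)
    also have "\<dots> \<le> 1" using bd[OF \<open>z \<in> _\<close>] c by (simp add: norm_mult)
    finally show "0 \<le> Re (p z)" by (simp add: p_def)
  qed (use n in \<open>auto simp: p_def[abs_def] intro!: holomorphic_intros hol\<close>)
  also have "Re (p 0) = 1 - cmod (b 0)" using c by (simp add: p_def)
  finally show ?thesis .
qed

text \<open>
  Bohr's theorem. As the sum of \<open>3\<^sup>-\<^sup>n\<close> over \<open>n \<ge> 1\<close> is \<open>1/2\<close>, the radius \<open>1/3\<close> is exactly where the
  coefficient bound \<open>2 (1 - \<bar>b(0)\<bar>)\<close> yields \<open>\<bar>b(0)\<bar> + (1 - \<bar>b(0)\<bar>) = 1\<close>.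
\<close>

lemma bohr_partial_sum:
  fixes b :: "complex \<Rightarrow> complex"
  assumes hol: "b holomorphic_on ball 0 1"
    and bd: "\<And>z. z \<in> ball 0 1 \<Longrightarrow> cmod (b z) \<le> 1" and t: "0 \<le> t" "t \<le> 1/3"
  shows "(\<Sum>n\<le>N. cmod (taylor_coeff b n) * t ^ n) \<le> 1"
proof -
  define \<beta> where "\<beta> = cmod (b 0)"
  have \<beta>: "0 \<le> \<beta>" "\<beta> \<le> 1" using bd[of 0] by (auto simp: \<beta>_def)
  have b0: "cmod (taylor_coeff b 0) = \<beta>" by (simp add: fps_expansion_def \<beta>_def)
  have "(\<Sum>n\<le>N. cmod (taylor_coeff b n) * t ^ n) = \<beta> + (\<Sum>n=1..N. cmod (taylor_coeff b n) * t ^ n)"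
    using b0 by (simp add: atMost_atLeast0 sum.atLeast_Suc_atMost)
  also have "(\<Sum>n=1..N. cmod (taylor_coeff b n) * t ^ n) \<le> (\<Sum>n=1..N. 2 * (1 - \<beta>) * (1/3) ^ n)"
    using bounded_coeff_bound[OF hol bd] t \<beta> unfolding \<beta>_def
    by (intro sum_mono mult_mono power_mono) auto
  also have "\<dots> = 2 * (1 - \<beta>) * (\<Sum>n=1..N. (1/3) ^ n)" by (simp add: sum_distrib_left)
  also have "(\<Sum>n=1..N. (1/3) ^ n) \<le> (1/2 :: real)"
  proof -
    have "(\<Sum>n=1..N. (1/3) ^ n) = (1 - (1/3) ^ N) / (2::real)"
    proof (induction N)
      case (Suc N)
      have "(\<Sum>n=1..Suc N. (1/3::real) ^ n) = (\<Sum>n=1..N. (1/3) ^ n) + (1/3) ^ Suc N" by simp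
      also have "\<dots> = (1 - (1/3) ^ Suc N) / 2" unfolding Suc.IH by (simp add: field_simps)
      finally show ?case .
    qed simp
    thus ?thesis by simp
  qed
  hence "\<beta> + 2 * (1 - \<beta>) * (\<Sum>n=1..N. (1/3) ^ n) \<le> \<beta> + 2 * (1 - \<beta>) * (1/2)"
    using \<beta> by (intro add_left_mono mult_left_mono) auto
  finally show ?thesis by (simp add: algebra_simps diff_divide_distrib)
qed

lemma divide_zero_holomorphic:
  fixes w :: "complex \<Rightarrow> complex"
  assumes hol: "w holomorphic_on ball 0 r" and w0: "w 0 = 0"
  obtains \<eta> where "\<eta> holomorphic_on ball 0 r" "\<And>z. z \<in> ball 0 r \<Longrightarrow> w z = z * \<eta> z" "\<eta> 0 = deriv w 0"
proof
  show "(\<lambda>z. if z = 0 then deriv w 0 else (w z - w 0) / (z - 0)) holomorphic_on ball 0 r"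
    by (rule pole_lemma_open[OF hol]) auto
qed (use w0 in auto)

lemma schwarz_quotient:
  fixes w :: "complex \<Rightarrow> complex"
  assumes hol: "w holomorphic_on ball 0 1" and w0: "w 0 = 0"
    and bd: "\<And>z. z \<in> ball 0 1 \<Longrightarrow> cmod (w z) < 1"
  shows "\<exists>\<eta>. \<eta> holomorphic_on ball 0 1 \<and> \<eta> 0 = deriv w 0 \<and>
    (\<forall>z\<in>ball 0 1. w z = z * \<eta> z \<and> cmod (\<eta> z) \<le> 1)"
proof -
  obtain \<eta> where \<eta>: "\<eta> holomorphic_on ball 0 1" "\<And>z. z \<in> ball 0 1 \<Longrightarrow> w z = z * \<eta> z" "\<eta> 0 = deriv w 0"
    using divide_zero_holomorphic[OF hol w0] by blast
  have "cmod (\<eta> z) \<le> 1" if z: "z \<in> ball 0 1" for z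
  proof (cases "z = 0")
    case True thus ?thesis using Schwarz_Lemma(2)[OF hol w0 _ , of 0] bd \<eta> by simp
  next
    case False
    have "cmod (w z) \<le> cmod z" using Schwarz_Lemma(1)[OF hol w0, of z] bd z by simp
    thus ?thesis using False \<eta>(2)[OF z] by (simp add: norm_mult)
  qed
  with \<eta> show ?thesis by (intro exI[of _ \<eta>]) auto
qed

text \<open>
  By the Schwarz lemma \<open>w\<^sup>k = z\<^sup>k b\<close> with \<open>\<bar>b\<bar> \<le> 1\<close>, so that Bohr's theorem applies to \<open>b\<close>.
\<close>

lemma schwarz_power_partial_sum:
  fixes w :: "complex \<Rightarrow> complex"
  assumes hol: "w holomorphic_on ball 0 1" and w0: "w 0 = 0"
    and bd: "\<And>z. z \<in> ball 0 1 \<Longrightarrow> cmod (w z) < 1" and t: "0 \<le> t" "t \<le> 1/3"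
  shows "(\<Sum>n\<le>N. cmod (fps_nth (fps_expansion w 0 ^ k) n) * t ^ n) \<le> t ^ k"
proof -
  obtain \<eta> where \<eta>: "\<eta> holomorphic_on ball 0 1" "\<And>z. z \<in> ball 0 1 \<Longrightarrow> w z = z * \<eta> z"
    "\<And>z. z \<in> ball 0 1 \<Longrightarrow> cmod (\<eta> z) \<le> 1" "\<eta> 0 = deriv w 0"
    using schwarz_quotient[OF hol w0 bd] by metis
  define b where "b z = \<eta> z ^ k" for z
  have holb: "b holomorphic_on ball 0 1" unfolding b_def by (intro holomorphic_intros \<eta>(1))
  have bdb: "cmod (b z) \<le> 1" if "z \<in> ball 0 1" for z
    using \<eta>(3)[OF that] by (simp add: b_def norm_power power_le_one)
  have e: "\<eta> has_fps_expansion fps_expansion \<eta> 0"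
    using \<eta>(1) by (intro has_fps_expansion_fps_expansion[of "ball 0 1"]) auto
  have B: "fps_expansion b 0 = fps_expansion \<eta> 0 ^ k"
    unfolding b_def[abs_def] by (intro fps_expansion_eqI has_fps_expansion_power e)
  have "(\<lambda>z. z * \<eta> z) has_fps_expansion fps_X * fps_expansion \<eta> 0"
    by (intro has_fps_expansion_mult has_fps_expansion_fps_X e)
  moreover have "eventually (\<lambda>z. z * \<eta> z = w z) (nhds 0)"
    by (rule eventually_mono[OF eventually_nhds_in_open[of "ball 0 1" "0::complex"]])
      (use \<eta>(2) in auto)
  ultimately have "w has_fps_expansion fps_X * fps_expansion \<eta> 0"
    using has_fps_expansion_cong[of "\<lambda>z. z * \<eta> z" w] by simp
  hence "fps_expansion w 0 = fps_X * fps_expansion \<eta> 0"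
    by (rule fps_expansion_eqI)
  hence "fps_expansion w 0 ^ k = fps_X ^ k * fps_expansion b 0"
    unfolding B by (simp only: power_mult_distrib)
  hence c: "fps_nth (fps_expansion w 0 ^ k) n = (if n < k then 0 else taylor_coeff b (n - k))" for n
    by (simp add: fps_X_power_mult_nth)
  have "(\<Sum>n\<le>N. cmod (fps_nth (fps_expansion w 0 ^ k) n) * t ^ n)
      = (\<Sum>n\<in>{n. n \<le> N \<and> k \<le> n}. cmod (taylor_coeff b (n - k)) * t ^ n)"
    by (rule sum.mono_neutral_cong_right) (auto simp: c)
  also have "\<dots> \<le> (\<Sum>n\<in>{k..N+k}. cmod (taylor_coeff b (n - k)) * t ^ n)"
    using t by (intro sum_mono2) auto
  also have "\<dots> = (\<Sum>n\<le>N. cmod (taylor_coeff b n) * t ^ (n + k))"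
    by (rule sum.reindex_bij_witness[of _ "\<lambda>n. n + k" "\<lambda>n. n - k"]) auto
  also have "\<dots> = t ^ k * (\<Sum>n\<le>N. cmod (taylor_coeff b n) * t ^ n)"
    by (simp add: sum_distrib_left power_add mult_ac)
  also have "\<dots> \<le> t ^ k * 1"
    by (rule mult_left_mono[OF bohr_partial_sum[OF holb bdb t]]) (use t in auto)
  finally show ?thesis by simp
qed

lemma taylor_summable:
  assumes "f holomorphic_on ball 0 1" "0 \<le> t" "t < 1"
  shows "summable (\<lambda>n. cmod (taylor_coeff f n) * t ^ n)"
proof -
  have "fps_conv_radius (fps_expansion f 0) \<ge> ereal 1"
    by (rule conv_radius_fps_expansion) (use assms in simp)
  hence "ereal (norm (of_real t :: complex)) < fps_conv_radius (fps_expansion f 0)"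
    using assms less_le_trans[of "ereal t" "ereal 1"] by simp
  from norm_summable_fps[OF this] show ?thesis
    using assms by (simp add: norm_mult norm_power)
qed

text \<open>
  The \<open>n\<close>-th coefficient of \<open>\<phi> \<circ> w\<close> combines the \<open>n\<close>-th coefficients of the powers \<open>w\<^sup>k\<close> with weights
  \<open>\<phi>\<^sub>k\<close>. Exchanging the two summations reduces the claim to the powers of \<open>w\<close>.
\<close>

lemma majorant_subordinate_partial_sum:
  fixes \<phi> w :: "complex \<Rightarrow> complex"
  assumes hol\<phi>: "\<phi> holomorphic_on ball 0 1"
    and hol: "w holomorphic_on ball 0 1" and w0: "w 0 = 0"
    and bd: "\<And>z. z \<in> ball 0 1 \<Longrightarrow> cmod (w z) < 1" and t: "0 \<le> t" "t \<le> 1/3"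
  shows "(\<Sum>n\<le>N. cmod (taylor_coeff (\<phi> \<circ> w) n) * t ^ n) \<le> majorant \<phi> t"
proof -
  let ?P = "fps_expansion \<phi> 0" and ?W = "fps_expansion w 0"
  have e: "\<phi> has_fps_expansion ?P" "w has_fps_expansion ?W"
    using hol\<phi> hol by (auto intro!: has_fps_expansion_fps_expansion[of "ball 0 1"])
  have "fps_nth ?W 0 = 0" using w0 by (simp add: fps_expansion_def)
  hence "(\<phi> \<circ> w) has_fps_expansion fps_compose ?P ?W"
    by (intro has_fps_expansion_compose e)
  hence c: "taylor_coeff (\<phi> \<circ> w) n = (\<Sum>k=0..n. fps_nth ?P k * fps_nth (?W ^ k) n)" for n
    by (simp add: taylor_coeff_eqI fps_compose_nth)
  have "(\<Sum>n\<le>N. cmod (taylor_coeff (\<phi> \<circ> w) n) * t ^ n)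
    \<le> (\<Sum>n\<le>N. (\<Sum>k\<le>N. cmod (fps_nth ?P k) * cmod (fps_nth (?W ^ k) n)) * t ^ n)"
  proof (intro sum_mono mult_right_mono)
    fix n assume "n \<in> {..N}"
    have "cmod (taylor_coeff (\<phi> \<circ> w) n) \<le> (\<Sum>k=0..n. cmod (fps_nth ?P k) * cmod (fps_nth (?W ^ k) n))"
      unfolding c by (rule sum_norm_le) (simp add: norm_mult)
    also have "\<dots> \<le> (\<Sum>k\<le>N. cmod (fps_nth ?P k) * cmod (fps_nth (?W ^ k) n))"
      using \<open>n \<in> _\<close> by (intro sum_mono2) auto
    finally show "cmod (taylor_coeff (\<phi> \<circ> w) n) \<le> \<dots>" .
  qed (use t in auto)
  also have "\<dots> = (\<Sum>k\<le>N. cmod (fps_nth ?P k) * (\<Sum>n\<le>N. cmod (fps_nth (?W ^ k) n) * t ^ n))"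
    unfolding sum_distrib_left sum_distrib_right by (subst sum.swap) (simp add: mult_ac)
  also have "\<dots> \<le> (\<Sum>k\<le>N. cmod (fps_nth ?P k) * t ^ k)"
    by (intro sum_mono mult_left_mono schwarz_power_partial_sum hol w0 bd t) auto
  also have "\<dots> \<le> majorant \<phi> t"
    unfolding majorant_def
    by (rule sum_le_suminf) (use t taylor_summable[OF hol\<phi>] in auto)
  finally show ?thesis .
qed

section \<open>Odd starlike functions\<close>

lemma norm_square_has_derivative:
  fixes h :: "real \<Rightarrow> complex"
  assumes "(h has_vector_derivative h') (at t)"
  shows "((\<lambda>t. (cmod (h t))\<^sup>2) has_real_derivative 2 * Re (cnj (h t) * h')) (at t)"
proof -
  have "((\<lambda>t. Re (h t)) has_real_derivative Re h') (at t)" "((\<lambda>t. Im (h t)) has_real_derivative Im h') (at t)"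
    using bounded_linear.has_vector_derivative[OF bounded_linear_Re assms]
      bounded_linear.has_vector_derivative[OF bounded_linear_Im assms]
    by (auto simp: has_real_derivative_iff_has_vector_derivative)
  from DERIV_add[OF DERIV_power[OF this(1), of 2] DERIV_power[OF this(2), of 2]]
  have "((\<lambda>t. (Re (h t))\<^sup>2 + (Im (h t))\<^sup>2) has_real_derivative 2 * Re (cnj (h t) * h')) (at t)"
    by (simp add: algebra_simps)
  thus ?thesis by (simp add: cmod_power2)
qed

text \<open>
  The Schwarz lemma, applied a second time to \<open>u(z) / z\<close>. The quotient has modulus strictly less
  than 1, since otherwise \<open>u\<close> would be a rotation and \<open>u'(0)\<close> would not vanish.
\<close>

lemma schwarz_double_zero:
  fixes u :: "complex \<Rightarrow> complex"
  assumes hol: "u holomorphic_on ball 0 1" and u0: "u 0 = 0" and u'0: "deriv u 0 = 0"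
    and bd: "\<And>z. z \<in> ball 0 1 \<Longrightarrow> cmod (u z) < 1" and z: "z \<in> ball 0 1"
  shows "cmod (u z) \<le> (cmod z)\<^sup>2"
proof -
  obtain \<eta> where \<eta>: "\<eta> holomorphic_on ball 0 1" "\<And>z. z \<in> ball 0 1 \<Longrightarrow> u z = z * \<eta> z"
    "\<And>z. z \<in> ball 0 1 \<Longrightarrow> cmod (\<eta> z) \<le> 1" "\<eta> 0 = deriv u 0"
    using schwarz_quotient[OF hol u0 bd] by metis
  have "cmod (\<eta> z) < 1" if z: "z \<in> ball 0 1" for z
  proof (rule ccontr)
    assume "\<not> cmod (\<eta> z) < 1"
    hence 1: "cmod (\<eta> z) = 1" using \<eta>(3)[OF z] by simp
    have "z \<noteq> 0" using 1 \<eta>(4) u'0 by auto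
    moreover have "cmod (u z) = cmod z" using \<eta>(2)[OF z] 1 by (simp add: norm_mult)
    ultimately obtain \<alpha> where \<alpha>: "\<And>z. norm z < 1 \<Longrightarrow> u z = \<alpha> * z" "norm \<alpha> = 1"
      using Schwarz_Lemma(3)[OF hol u0 _, of 0] bd z by fastforce
    have "((\<lambda>z. \<alpha> * z) has_field_derivative \<alpha>) (at 0)"
      by (auto intro!: derivative_eq_intros)
    hence "(u has_field_derivative \<alpha>) (at 0)"
      by (rule has_field_derivative_transform_within_open[of _ _ _ "ball 0 1"]) (use \<alpha> in auto)
    hence "deriv u 0 = \<alpha>" by (rule DERIV_imp_deriv)
    thus False using \<alpha> u'0 by simp
  qed
  hence "cmod (\<eta> z) \<le> cmod z"
    using Schwarz_Lemma(1)[OF \<eta>(1), of z] \<eta>(4) u'0 z by simp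
  thus ?thesis using \<eta>(2)[OF z] by (simp add: norm_mult power2_eq_square mult_left_mono)
qed

lemma norm_le_1_on_cball:
  fixes u :: "complex \<Rightarrow> complex"
  assumes hol: "u holomorphic_on ball 0 1" and less: "\<And>z. cmod z < \<rho> \<Longrightarrow> cmod (u z) < 1"
    and \<rho>: "0 < \<rho>" "\<rho> < 1" and z: "cmod z \<le> \<rho>"
  shows "cmod (u z) \<le> 1"
proof (rule continuous_on_closure_norm_le[of "ball 0 \<rho>" u 1 z])
  show "continuous_on (closure (ball 0 \<rho>)) u"
    by (rule continuous_on_subset[OF holomorphic_on_imp_continuous_on[OF hol]]) (use \<rho> in auto)
  show "\<forall>y\<in>ball 0 \<rho>. cmod (u y) \<le> 1" using less by (auto intro: less_imp_le)
  show "z \<in> closure (ball 0 \<rho>)" using z \<rho> by simp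
qed

text \<open>
  The point \<open>z\<^sub>0\<close> maximizes \<open>\<bar>u\<bar>\<close> on its circle, so the angular derivative of \<open>\<bar>u\<bar>\<^sup>2\<close> vanishes there and
  \<open>q = z\<^sub>0 u'(z\<^sub>0) / u(z\<^sub>0)\<close> is real. Radially \<open>\<bar>u(s z\<^sub>0)\<bar> \<le> s\<^sup>2\<close> with equality at \<open>s = 1\<close>; comparing the
  derivatives of \<open>\<bar>u(s z\<^sub>0)\<bar>\<^sup>2\<close> and \<open>s\<^sup>4\<close> at \<open>s = 1\<close> gives \<open>q \<ge> 2\<close>.
\<close>

lemma jack_double_zero:
  fixes u :: "complex \<Rightarrow> complex"
  assumes hol: "u holomorphic_on ball 0 1" and u0: "u 0 = 0" and u'0: "deriv u 0 = 0"
    and z0: "z0 \<in> ball 0 1" "cmod (u z0) = 1"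
    and less: "\<And>z. cmod z < cmod z0 \<Longrightarrow> cmod (u z) < 1"
  obtains m :: real where "2 \<le> m" "z0 * deriv u z0 = of_real m * u z0"
proof -
  have z0nz: "z0 \<noteq> 0" using z0 u0 by auto
  have le: "cmod (u z) \<le> 1" if "cmod z \<le> cmod z0" for z
    by (rule norm_le_1_on_cball[OF hol less]) (use z0nz z0 that in auto)
  have du: "(u has_field_derivative deriv u z) (at z)" if "z \<in> ball 0 1" for z
    using hol that by (auto intro: holomorphic_derivI)
  \<comment> \<open>this is \<open>z\<^sub>0 u'(z\<^sub>0) / u(z\<^sub>0)\<close> because \<open>\<bar>u(z\<^sub>0)\<bar> = 1\<close>\<close>
  define q where "q = cnj (u z0) * (z0 * deriv u z0)"
  have uc: "cnj (u z0) * u z0 = 1"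
    using complex_norm_square[of "u z0"] z0(2) by (simp add: mult.commute)
  have small: "cmod (u (of_real s * z0)) \<le> s\<^sup>2" if "0 \<le> s" "s < 1" for s
  proof -
    define v where "v z = u (z0 * z)" for z
    have in1: "z0 * z \<in> ball 0 1" if "z \<in> ball 0 1" for z
      using that z0 by (simp add: norm_mult) (metis mult_strict_mono' norm_ge_zero mult_1)
    have "cmod (v (of_real s)) \<le> (cmod (of_real s))\<^sup>2"
    proof (rule schwarz_double_zero)
      have "u \<circ> (\<lambda>z. z0 * z) holomorphic_on ball 0 1"
        by (rule holomorphic_on_compose_gen[OF _ hol]) (use in1 in \<open>auto intro!: holomorphic_intros\<close>)
      thus "v holomorphic_on ball 0 1" by (simp add: v_def[abs_def] o_def)
      have "(v has_field_derivative deriv u (z0 * 0) * z0) (at 0)"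
        unfolding v_def[abs_def]
        by (rule DERIV_chain2[OF du]) (auto intro!: derivative_eq_intros)
      thus "deriv v 0 = 0" using u'0 DERIV_imp_deriv by fastforce
      show "cmod (v z) < 1" if "z \<in> ball 0 1" for z
        unfolding v_def by (rule less) (use that z0nz in \<open>simp add: norm_mult\<close>)
    qed (use u0 that in \<open>auto simp: v_def\<close>)
    thus ?thesis using that by (simp add: v_def mult.commute)
  qed
  have Re: "2 \<le> Re q"
  proof (rule ccontr)
    assume neg: "\<not> 2 \<le> Re q"
    have "((\<lambda>x. u (x * z0)) has_field_derivative deriv u (of_real 1 * z0) * z0) (at (of_real 1))"
      by (rule DERIV_chain2[OF du]) (use z0 in \<open>auto intro!: derivative_eq_intros\<close>)
    hence "((\<lambda>x. u (of_real x * z0)) has_vector_derivative deriv u z0 * z0) (at 1)"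
      using has_vector_derivative_real_field by fastforce
    from norm_square_has_derivative[OF this]
    have "((\<lambda>x. (cmod (u (of_real x * z0)))\<^sup>2) has_real_derivative 2 * Re q) (at 1)"
      by (simp add: q_def mult_ac)
    from DERIV_diff[OF this DERIV_pow[of 4]]
    have "((\<lambda>x. (cmod (u (of_real x * z0)))\<^sup>2 - x ^ 4) has_real_derivative 2 * Re q - 4) (at 1)"
      by simp
    from DERIV_neg_dec_left[OF this] neg obtain d where d: "d > 0"
      "\<And>h. 0 < h \<Longrightarrow> h < d \<Longrightarrow> (cmod (u (of_real (1 - h) * z0)))\<^sup>2 - (1 - h) ^ 4 > 0"
      using z0 by auto
    define h where "h = min (d / 2) (1 / 2)"
    have h: "0 < h" "h < d" "h \<le> 1/2" using d(1) by (auto simp: h_def)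
    have "(cmod (u (of_real (1 - h) * z0)))\<^sup>2 \<le> ((1 - h)\<^sup>2)\<^sup>2"
      by (rule power_mono[OF small]) (use h in auto)
    thus False using d(2)[OF h(1,2)] by simp
  qed
  have Im: "Im q = 0"
  proof -
    have "((\<lambda>x. u (z0 * exp (\<i> * x))) has_field_derivative deriv u (z0 * exp (\<i> * of_real 0)) * (z0 * \<i>)) (at (of_real 0))"
      by (rule DERIV_chain2[OF du]) (use z0 in \<open>auto intro!: derivative_eq_intros\<close>)
    hence "((\<lambda>x. u (z0 * exp (\<i> * of_real x))) has_vector_derivative deriv u z0 * (z0 * \<i>)) (at 0)"
      using has_vector_derivative_real_field by fastforce
    from norm_square_has_derivative[OF this]
    have D: "((\<lambda>x. (cmod (u (z0 * exp (\<i> * of_real x))))\<^sup>2) has_real_derivative 2 * Re (q * \<i>)) (at 0)"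
      by (simp add: q_def mult_ac)
    have "2 * Re (q * \<i>) = 0"
      by (rule DERIV_local_max[OF D, of 1])
        (use z0(2) le in \<open>auto simp: norm_mult intro!: power_le_one\<close>)
    thus ?thesis by simp
  qed
  have "z0 * deriv u z0 = u z0 * q"
    using uc by (simp add: q_def mult_ac)
  also have "q = of_real (Re q)" using Im by (simp add: complex_eq_iff)
  finally show ?thesis using that[of "Re q"] Re by (simp add: mult.commute)
qed

text \<open>
  These are the functions \<open>E(z) = G(z) / z\<close> for odd \<open>G\<close> that are starlike with respect to the origin:
  the quantity in the last assumption is \<open>z G'(z) / G(z)\<close>.
\<close>

locale even_starlike =
  fixes E :: "complex \<Rightarrow> complex"
  assumes hol: "E holomorphic_on ball 0 1" and E0: "E 0 = 1"
    and nz: "\<And>z. z \<in> ball 0 1 \<Longrightarrow> E z \<noteq> 0"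
    and even: "\<And>z. z \<in> ball 0 1 \<Longrightarrow> E (- z) = E z"
    and star: "\<And>z. z \<in> ball 0 1 \<Longrightarrow> 0 < Re (1 + z * deriv E z / E z)"
begin

lemma coeff_odd:
  assumes "odd n" shows "taylor_coeff E n = 0"
proof -
  have "(deriv ^^ n) (\<lambda>w. E (-1 * w)) 0 = (-1) ^ n * (deriv ^^ n) E (-1 * 0)"
    by (rule higher_deriv_compose_linear[OF hol, where S = "ball 0 1"]) auto
  moreover have "(deriv ^^ n) (\<lambda>w. E (-1 * w)) 0 = (deriv ^^ n) E 0"
    by (rule higher_deriv_cong_ev[OF eventually_mono[OF eventually_nhds_in_open[of "ball 0 1" 0]]])
      (auto simp: even)
  ultimately show ?thesis using assms by (simp add: fps_expansion_def)
qed

text \<open>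
  The extremal case \<open>E(z) = 1 / (1 - z\<^sup>2)\<close> corresponds to \<open>u(z) = z\<^sup>2\<close>.
\<close>

definition u where "u z = 1 - inverse (E z)"

lemma u_hol: "u holomorphic_on ball 0 1"
  unfolding u_def[abs_def] by (intro holomorphic_intros hol nz)

lemma u_0: "u 0 = 0" by (simp add: u_def E0)

lemma deriv_u:
  assumes "z \<in> ball 0 1" shows "deriv u z = deriv E z / (E z)\<^sup>2"
proof -
  have "(E has_field_derivative deriv E z) (at z)"
    using hol assms by (auto intro: holomorphic_derivI)
  hence "(u has_field_derivative deriv E z / (E z)\<^sup>2) (at z)"
    unfolding u_def[abs_def] using nz[OF assms]
    by (auto intro!: derivative_eq_intros simp: field_simps power2_eq_square)
  thus ?thesis by (rule DERIV_imp_deriv)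
qed

lemma deriv_u_0: "deriv u 0 = 0"
  using coeff_odd[of 1] deriv_u[of 0] by (simp add: fps_expansion_def)

text \<open>
  Where \<open>\<bar>u\<bar>\<close> first reaches 1, \<open>\<bar>E - 1\<bar> = \<bar>E\<bar>\<close> forces \<open>Re E = 1/2\<close>. As \<open>z E' / E = m (E - 1)\<close> with \<open>m \<ge> 2\<close>
  by Jack's lemma, \<open>Re (1 + z E' / E) = 1 - m / 2 \<le> 0\<close>, which contradicts starlikeness.
\<close>

lemma norm_u_less_1:
  assumes "z1 \<in> ball 0 1" shows "cmod (u z1) < 1"
proof (rule ccontr)
  assume neg: "\<not> cmod (u z1) < 1"
  define S where "S = {z \<in> cball 0 (cmod z1). 1 \<le> cmod (u z)}"
  have sub: "cball 0 (cmod z1) \<subseteq> ball (0::complex) 1" using assms by auto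
  have cont: "continuous_on (cball 0 (cmod z1)) (\<lambda>z. cmod (u z))"
    using holomorphic_on_imp_continuous_on[OF u_hol] sub
    by (auto intro!: continuous_intros intro: continuous_on_subset)
  have "S = cball 0 (cmod z1) \<inter> (\<lambda>z. cmod (u z)) -` {1..}" by (auto simp: S_def)
  hence "closed S" by (simp add: continuous_closed_preimage[OF cont])
  moreover have "bounded S"
    by (rule bounded_subset[OF bounded_cball[of 0 "cmod z1"]]) (auto simp: S_def)
  ultimately have comp: "compact S" by (simp add: compact_eq_bounded_closed)
  have "z1 \<in> S" using neg by (auto simp: S_def)
  obtain z0 where z0: "z0 \<in> S" "\<And>z. z \<in> S \<Longrightarrow> cmod z0 \<le> cmod z"
    using continuous_attains_inf[OF comp _ continuous_on_norm_id] \<open>z1 \<in> S\<close> by auto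
  have z0b: "z0 \<in> ball 0 1" using z0(1) sub by (auto simp: S_def)
  have less: "cmod (u z) < 1" if "cmod z < cmod z0" for z
    using z0(2)[of z] that z0(1) by (force simp: S_def)
  have "z0 \<noteq> 0" using z0(1) u_0 by (auto simp: S_def)
  have "cmod (u z0) \<le> 1"
    by (rule norm_le_1_on_cball[OF u_hol less]) (use \<open>z0 \<noteq> 0\<close> z0b in auto)
  hence u1: "cmod (u z0) = 1" using z0(1) by (simp add: S_def)
  obtain m where m: "2 \<le> m" "z0 * deriv u z0 = of_real m * u z0"
    by (rule jack_double_zero[OF u_hol u_0 deriv_u_0 z0b u1 less])
  have Enz: "E z0 \<noteq> 0" by (rule nz[OF z0b])
  have uE: "u z0 * E z0 = E z0 - 1" using Enz by (simp add: u_def algebra_simps)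
  have "z0 * deriv E z0 / E z0 = z0 * deriv u z0 * E z0"
    unfolding deriv_u[OF z0b] using Enz by (simp add: power2_eq_square)
  also have "\<dots> = of_real m * (E z0 - 1)" unfolding m(2) mult.assoc uE ..
  finally have eq: "Re (1 + z0 * deriv E z0 / E z0) = 1 + m * (Re (E z0) - 1)" by simp
  have "cmod (E z0 - 1) = cmod (E z0)" using u1 by (simp flip: uE add: norm_mult)
  hence "(cmod (E z0 - 1))\<^sup>2 = (cmod (E z0))\<^sup>2" by simp
  hence ReE: "Re (E z0) = 1/2" unfolding cmod_power2 by (simp add: power2_eq_square algebra_simps)
  have "1 + m * (Re (E z0) - 1) = 1 - m / 2" unfolding ReE by simp
  thus False using star[OF z0b] m(1) unfolding eq by simp
qed

lemma Re_E:
  assumes "z \<in> ball 0 1" shows "1/2 < Re (E z)"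
proof -
  have "u z * E z = E z - 1" using nz[OF assms] by (simp add: u_def algebra_simps)
  moreover have "cmod (u z * E z) < cmod (E z)"
    using norm_u_less_1[OF assms] nz[OF assms] by (simp add: norm_mult)
  ultimately have "(cmod (E z - 1))\<^sup>2 < (cmod (E z))\<^sup>2" by (simp add: power_strict_mono)
  thus ?thesis unfolding cmod_power2 by (simp add: power2_eq_square algebra_simps)
qed

text \<open>
  \<open>1 / E = 1 - u\<close>, and \<open>\<bar>u(z)\<bar> \<le> \<bar>z\<bar>\<^sup>2\<close> since \<open>u\<close> has a double zero at the origin.
\<close>

lemma norm_E_ge:
  assumes "z \<in> ball 0 1" shows "inverse (1 + (cmod z)\<^sup>2) \<le> cmod (E z)"
proof -
  have "cmod (u z) \<le> (cmod z)\<^sup>2"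
    by (rule schwarz_double_zero[OF u_hol u_0 deriv_u_0 norm_u_less_1 assms])
  moreover have "cmod (1 - u z) \<le> 1 + cmod (u z)" using norm_triangle_ineq4[of 1 "u z"] by simp
  ultimately have "inverse (cmod (E z)) \<le> 1 + (cmod z)\<^sup>2" by (simp add: u_def norm_inverse)
  thus ?thesis using nz[OF assms]
    by (metis inverse_inverse_eq le_imp_inverse_le norm_eq_zero positive_imp_inverse_positive zero_less_norm_iff)
qed

text \<open>
  \<open>2 E - 1\<close> has positive real part and the value 1 at the origin.
\<close>

lemma coeff_le_1: "cmod (taylor_coeff E n) \<le> 1"
proof (cases "n = 0")
  case True thus ?thesis by (simp add: fps_expansion_def E0)
next
  case False
  define p where "p z = 2 * E z - 1" for z
  have fe: "E has_fps_expansion fps_expansion E 0"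
    using hol by (intro has_fps_expansion_fps_expansion[of "ball 0 1"]) auto
  have "p has_fps_expansion fps_const 2 * fps_expansion E 0 - 1"
    unfolding p_def[abs_def] by (intro has_fps_expansion_diff has_fps_expansion_cmult_left has_fps_expansion_1 fe)
  hence "taylor_coeff p n = 2 * taylor_coeff E n" using False by (simp add: taylor_coeff_eqI)
  moreover have "cmod (taylor_coeff p n) \<le> 2 * Re (p 0)"
  proof (rule caratheodory_coeff_bound)
    show "p holomorphic_on ball 0 1" unfolding p_def[abs_def] by (intro holomorphic_intros hol)
    show "0 \<le> Re (p z)" if "z \<in> ball 0 1" for z using Re_E[OF that] by (simp add: p_def)
  qed (use False in auto)
  ultimately show ?thesis by (simp add: p_def E0 norm_mult)
qed

text \<open>
  Only even exponents occur, so the geometric series in \<open>t\<^sup>2\<close> dominates.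
\<close>

lemma partial_sum_le:
  assumes "0 \<le> t" "t < 1"
  shows "(\<Sum>n\<le>N. cmod (taylor_coeff E n) * t ^ n) \<le> 1 / (1 - t\<^sup>2)"
proof -
  have "(\<Sum>n\<le>N. cmod (taylor_coeff E n) * t ^ n) \<le> (\<Sum>n\<le>2*N+1. cmod (taylor_coeff E n) * t ^ n)"
    using assms by (intro sum_mono2) auto
  also have "\<dots> = (\<Sum>n\<in>(\<lambda>k. 2*k) ` {..N}. cmod (taylor_coeff E n) * t ^ n)"
  proof (rule sum.mono_neutral_right)
    show "\<forall>n\<in>{..2 * N + 1} - (\<lambda>k. 2*k) ` {..N}. cmod (taylor_coeff E n) * t ^ n = 0"
    proof
      fix n assume n: "n \<in> {..2 * N + 1} - (\<lambda>k. 2*k) ` {..N}"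
      have "odd n"
      proof
        assume "even n"
        then obtain k where k: "n = 2 * k" by (auto elim: evenE)
        with n have "k \<in> {..N}" by auto
        with n k show False by auto
      qed
      thus "cmod (taylor_coeff E n) * t ^ n = 0" by (simp add: coeff_odd)
    qed
  qed auto
  also have "\<dots> = (\<Sum>k\<le>N. cmod (taylor_coeff E (2*k)) * (t\<^sup>2) ^ k)"
    by (subst sum.reindex) (auto simp: inj_on_def power_mult)
  also have "\<dots> \<le> (\<Sum>k\<le>N. (t\<^sup>2) ^ k)"
    using coeff_le_1 assms by (intro sum_mono mult_left_le_one_le) auto
  also have "\<dots> \<le> (\<Sum>k. (t\<^sup>2) ^ k)"
    using assms by (intro sum_le_suminf summable_geometric) (auto simp: power_less_one_iff)
  also have "\<dots> = 1 / (1 - t\<^sup>2)"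
    using assms by (intro suminf_geometric) (auto simp: power_less_one_iff)
  finally show ?thesis .
qed

end

section \<open>Convex and close-to-convex functions\<close>

lemma has_vector_derivative_on_line:
  fixes f :: "complex \<Rightarrow> complex" and t :: real
  assumes "(f has_field_derivative f') (at (c + of_real t * d))"
  shows "((\<lambda>t. f (c + of_real t * d)) has_vector_derivative f' * d) (at t)"
proof -
  have "((\<lambda>x. f (c + x * d)) has_field_derivative f' * d) (at (of_real t))"
    by (rule DERIV_chain2[of f f' "\<lambda>x. c + x * d"]) (use assms in \<open>auto intro!: derivative_eq_intros\<close>)
  thus ?thesis using has_vector_derivative_real_field by fastforce
qed

text \<open>
  Along the segment from \<open>a\<close> to \<open>b\<close> the real part of \<open>F / (b - a)\<close> has the derivative \<open>Re F' > 0\<close>, so it is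
  strictly increasing and \<open>F a = F b\<close> is impossible.
\<close>

lemma noshiro_warschawski:
  fixes F :: "complex \<Rightarrow> complex"
  assumes conv: "convex U"
    and der: "\<And>z. z \<in> U \<Longrightarrow> (F has_field_derivative F' z) (at z)"
    and pos: "\<And>z. z \<in> U \<Longrightarrow> 0 < Re (F' z)"
  shows "inj_on F U"
proof (rule inj_onI, rule ccontr)
  fix a b assume ab: "a \<in> U" "b \<in> U" "F a = F b" "a \<noteq> b"
  define G where "G t = Re (F (a + of_real t * (b - a)) / (b - a))" for t :: real
  have "G 0 < G 1"
  proof (rule DERIV_pos_imp_increasing[where f = G])
    fix t :: real assume t: "0 \<le> t" "t \<le> 1"
    have "(1 - t) *\<^sub>R a + t *\<^sub>R b \<in> U" using conv ab t by (intro convexD) auto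
    hence in_U: "a + of_real t * (b - a) \<in> U" by (simp add: scaleR_conv_of_real algebra_simps)
    have "((\<lambda>t. F (a + of_real t * (b - a)) / (b - a)) has_vector_derivative
        F' (a + of_real t * (b - a)) * (b - a) / (b - a)) (at t)"
      by (intro has_vector_derivative_divide has_vector_derivative_on_line der in_U)
    from bounded_linear.has_vector_derivative[OF bounded_linear_Re this]
    have "(G has_real_derivative Re (F' (a + of_real t * (b - a)))) (at t)"
      using ab(4) by (simp add: G_def[abs_def] has_real_derivative_iff_has_vector_derivative)
    thus "\<exists>y. (G has_real_derivative y) (at t) \<and> 0 < y" using pos[OF in_U] by blast
  qed simp
  thus False using ab(3) by (simp add: G_def)
qed

text \<open>
  The curvature condition says that the images of the circles around the origin turn monotonically.
  The locale fixes a univalent \<open>K\<close> together with its inverse function \<open>k\<close>.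
\<close>

locale convex_function =
  fixes K k :: "complex \<Rightarrow> complex"
  assumes K_hol: "K holomorphic_on ball 0 1"
    and k_hol: "k holomorphic_on K ` ball 0 1"
    and k_K: "\<And>z. z \<in> ball 0 1 \<Longrightarrow> k (K z) = z"
    and deriv_k_K: "\<And>z. z \<in> ball 0 1 \<Longrightarrow> deriv K z * deriv k (K z) = 1"
    and curvature: "\<And>z. z \<in> ball 0 1 \<Longrightarrow> 0 < Re (1 + z * deriv (deriv K) z / deriv K z)"
begin

abbreviation V where "V \<equiv> K ` ball 0 1"

lemma K_inj: "inj_on K (ball 0 1)"
  using k_K by (metis inj_onI)

lemma open_V: "open V"
  using open_mapping_thm3[OF K_hol _ K_inj] by simp

lemma k_in: "w \<in> V \<Longrightarrow> k w \<in> ball 0 1" and K_k: "w \<in> V \<Longrightarrow> K (k w) = w"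
  using k_K by auto

lemma deriv_K_nz: "z \<in> ball 0 1 \<Longrightarrow> deriv K z \<noteq> 0"
  using deriv_k_K by fastforce

lemma k_deriv:
  assumes "w \<in> V" shows "(k has_field_derivative inverse (deriv K (k w))) (at w)"
proof -
  have "deriv k w = inverse (deriv K (k w))"
    using deriv_k_K[OF k_in[OF assms]] deriv_K_nz[OF k_in[OF assms]] K_k[OF assms] by (simp add: field_simps)
  thus ?thesis using holomorphic_derivI[OF k_hol open_V assms] by simp
qed

text \<open>
  Let \<open>h\<close> parametrize the preimage of the segment. At an interior maximum of \<open>\<bar>h\<bar>\<^sup>2\<close> the velocity is
  tangential, \<open>h' = \<i> s h\<close>, and then the second derivative of \<open>\<bar>h\<bar>\<^sup>2\<close> is
  \<open>2 s\<^sup>2 \<bar>h\<bar>\<^sup>2 Re (1 + h K''(h) / K'(h)) > 0\<close>, which is absurd. So the maximum is at an endpoint.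
\<close>

lemma segment_preimage_norm_le:
  assumes ab: "a \<in> ball 0 1" "b \<in> ball 0 1" and seg: "closed_segment (K a) (K b) \<subseteq> V"
    and w: "w \<in> closed_segment (K a) (K b)"
  shows "cmod (k w) \<le> max (cmod a) (cmod b)"
proof (cases "K a = K b")
  case True thus ?thesis using w k_K[OF ab(1)] by simp
next
  case False
  define d where "d = K b - K a"
  have d: "d \<noteq> 0" using False by (simp add: d_def)
  define h where "h t = k (K a + of_real t * d)" for t :: real
  have in_V: "K a + of_real t * d \<in> V" if "t \<in> {0..1}" for t :: real
  proof -
    have "K a + of_real t * d \<in> closed_segment (K a) (K b)"
      using that by (auto simp: in_segment d_def scaleR_conv_of_real algebra_simps intro!: exI[of _ t])
    thus ?thesis using seg by blast
  qed
  have h_in: "h t \<in> ball 0 1" if "t \<in> {0..1}" for t unfolding h_def by (rule k_in[OF in_V[OF that]])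
  define h' where "h' t = inverse (deriv K (h t)) * d" for t
  have dh: "(h has_vector_derivative h' t) (at t)" if "t \<in> {0..1}" for t
    unfolding h_def[abs_def] h'_def
    by (intro has_vector_derivative_on_line k_deriv in_V that)
  define A where "A t = (cmod (h t))\<^sup>2" for t
  define m where "m t = 2 * Re (cnj (h t) * h' t)" for t
  have dA: "(A has_real_derivative m t) (at t)" if "t \<in> {0..1}" for t
    unfolding A_def[abs_def] m_def by (rule norm_square_has_derivative[OF dh[OF that]])
  have "continuous_on {0..1} A"
    by (rule DERIV_continuous_on) (use dA in \<open>auto intro: has_field_derivative_at_within\<close>)
  then obtain t0 where t0: "t0 \<in> {0..1}" "\<And>t. t \<in> {0..1} \<Longrightarrow> A t \<le> A t0"
    using continuous_attains_sup[of "{0..1::real}" A] by auto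
  have A_le: "A t0 \<le> (max (cmod a) (cmod b))\<^sup>2"
  proof (cases "t0 = 0 \<or> t0 = 1 \<or> h t0 = 0")
    case True
    have "h 0 = a" "h 1 = b" using k_K ab by (auto simp: h_def d_def)
    with True show ?thesis by (auto simp: A_def le_max_iff_disj intro!: power_mono)
  next
    case False
    hence t0': "0 < t0" "t0 < 1" "h t0 \<noteq> 0" using t0 by auto
    \<comment> \<open>\<open>m\<close> is the derivative of \<open>A\<close>; it vanishes at \<open>t0\<close>, but its own derivative there is positive\<close>
    define c where "c = deriv (deriv K) (h t0) / deriv K (h t0)"
    have m0: "m t0 = 0"
    proof (rule DERIV_local_max[OF dA[OF t0(1)], of "min t0 (1 - t0)"])
      show "\<forall>y. \<bar>t0 - y\<bar> < min t0 (1 - t0) \<longrightarrow> A y \<le> A t0"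
        by (auto intro!: t0(2))
    qed (use t0' in auto)
    have h'nz: "h' t0 \<noteq> 0" using d deriv_K_nz[OF h_in[OF t0(1)]] by (simp add: h'_def)
    define s where "s = Im (h' t0 / h t0)"
    have "Re (h' t0 / h t0) = 0"
      using m0 by (simp add: m_def Re_divide mult.commute)
    hence hs: "h' t0 = \<i> * s * h t0"
      using t0'(3) by (metis complex_eq mult.commute s_def nonzero_eq_divide_eq of_real_0 add_0)
    have s: "s \<noteq> 0" using hs h'nz by auto
    have dh': "(h' has_vector_derivative - c * (h' t0)\<^sup>2) (at t0)"
    proof -
      have "deriv K holomorphic_on ball 0 1" using K_hol by (auto intro: holomorphic_deriv)
      hence "(deriv K has_field_derivative deriv (deriv K) (h t0)) (at (h t0))"
        using h_in[OF t0(1)] by (auto intro: holomorphic_derivI)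
      hence "((\<lambda>z. inverse (deriv K z) * d) has_field_derivative
          - (inverse (deriv K (h t0)) * deriv (deriv K) (h t0) * inverse (deriv K (h t0))) * d) (at (h t0))"
        using deriv_K_nz[OF h_in[OF t0(1)]] by (auto intro!: derivative_eq_intros)
      from field_vector_diff_chain_at[OF dh[OF t0(1)] this]
      show ?thesis
        by (simp add: h'_def[abs_def] o_def c_def power2_eq_square field_simps)
    qed
    have dm: "(m has_real_derivative 2 * (s\<^sup>2 * (cmod (h t0))\<^sup>2 * Re (1 + h t0 * c))) (at t0)"
    proof -
      have "((\<lambda>t. cnj (h t) * h' t) has_vector_derivative cnj (h t0) * (- c * (h' t0)\<^sup>2) + cnj (h' t0) * h' t0) (at t0)"
        by (intro has_vector_derivative_mult dh' has_vector_derivative_cnj dh t0(1))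
      from bounded_linear.has_vector_derivative[OF bounded_linear_Re this]
      have "((\<lambda>t. Re (cnj (h t) * h' t)) has_real_derivative Re (cnj (h t0) * (- c * (h' t0)\<^sup>2) + cnj (h' t0) * h' t0)) (at t0)"
        by (simp add: has_real_derivative_iff_has_vector_derivative)
      from DERIV_cmult[OF this, of 2]
      have "(m has_real_derivative 2 * Re (cnj (h t0) * (- c * (h' t0)\<^sup>2) + cnj (h' t0) * h' t0)) (at t0)"
        by (simp add: m_def[abs_def])
      also have "cnj (h t0) * (- c * (h' t0)\<^sup>2) + cnj (h' t0) * h' t0
          = of_real (s\<^sup>2) * (h t0 * cnj (h t0)) * (1 + h t0 * c)"
        unfolding hs by (simp add: power2_eq_square algebra_simps)
      also have "\<dots> = of_real (s\<^sup>2 * (cmod (h t0))\<^sup>2) * (1 + h t0 * c)"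
        by (simp only: of_real_mult complex_norm_square)
      finally show ?thesis by simp
    qed
    have "0 < 2 * (s\<^sup>2 * (cmod (h t0))\<^sup>2 * Re (1 + h t0 * c))"
      using curvature[OF h_in[OF t0(1)]] s t0'(3) by (simp add: c_def)
    from DERIV_pos_inc_right[OF dm this] obtain e where e: "e > 0"
      "\<And>x. 0 < x \<Longrightarrow> x < e \<Longrightarrow> m t0 < m (t0 + x)" by auto
    define x where "x = min (e / 2) ((1 - t0) / 2)"
    have x: "0 < x" "x < e" "t0 + x < 1" using e t0' by (auto simp: x_def min_def field_simps)
    have "A t0 < A (t0 + x)"
    proof (rule DERIV_pos_imp_increasing_open[where f = A])
      show "\<exists>y. (A has_real_derivative y) (at t) \<and> 0 < y" if "t0 < t" "t < t0 + x" for t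
        using dA[of t] e(2)[of "t - t0"] m0 that x t0' by (intro exI[of _ "m t"]) auto
      show "continuous_on {t0..t0 + x} A"
        by (rule continuous_on_subset[OF \<open>continuous_on {0..1} A\<close>]) (use t0' x in auto)
    qed (use x in auto)
    thus ?thesis using t0(2)[of "t0 + x"] x t0' by auto
  qed
  obtain t where t: "t \<in> {0..1}" "w = K a + of_real t * d"
    using w by (auto simp: in_segment d_def scaleR_conv_of_real algebra_simps)
  have "(cmod (k w))\<^sup>2 = A t" by (simp add: t A_def h_def)
  also have "\<dots> \<le> (max (cmod a) (cmod b))\<^sup>2" using t0(2)[OF t(1)] A_le by linarith
  finally have "(cmod (k w))\<^sup>2 \<le> (max (cmod a) (cmod b))\<^sup>2" .
  thus ?thesis by (rule power2_le_imp_le) (simp add: max_def)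
qed

text \<open>
  For \<open>a\<close>, \<open>b\<close> in the disc consider the segments from \<open>K(s a)\<close> to \<open>K(s b)\<close> with \<open>s\<close> from 0 to 1. The set of
  all \<open>s\<close> for which the segment lies in \<open>V\<close> is open in \<open>[0, 1]\<close>, as \<open>V\<close> is open. It is also closed: by the
  previous lemma such a segment even lies in the compact image of a smaller closed disc whose radius is
  independent of \<open>s\<close>. It contains 0, hence also 1.
\<close>

lemma convex_V: "convex V"
proof -
  have "closed_segment (K a) (K b) \<subseteq> V" if ab: "a \<in> ball 0 1" "b \<in> ball 0 1" for a b
  proof -
    define \<Gamma> where "\<Gamma> s t = (1 - of_real t) * K (of_real s * a) + of_real t * K (of_real s * b)" for s t :: real
    define r where "r = max (cmod a) (cmod b)"
    define C where "C = K ` cball 0 r"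
    \<comment> \<open>\<open>T\<close> collects the good values of \<open>s\<close>, \<open>B\<close> the bad ones; both are closed\<close>
    define T where "T = (\<Inter>t\<in>{0..1}. {0..1} \<inter> (\<lambda>s. \<Gamma> s t) -` C)"
    define B where "B = fst ` (({0..1} \<times> {0..1}) \<inter> (\<lambda>(s,t). \<Gamma> s t) -` (- V))"
    have r: "r < 1" using ab by (simp add: r_def)
    have sc: "cmod (of_real s * z) \<le> cmod z" if "s \<in> {0..1}" for s :: real and z :: complex
      using that by (simp add: norm_mult mult_left_le_one_le)
    have sb: "of_real s * z \<in> ball 0 1" if "s \<in> {0..1}" "z \<in> ball 0 1" for s :: real and z :: complex
      using sc[OF that(1), of z] that(2) by simp
    have K_cont: "continuous_on (ball 0 1) K" by (rule holomorphic_on_imp_continuous_on[OF K_hol])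
    have K_cont': "continuous_on X (\<lambda>x. K (g x))" if "continuous_on X g" "\<And>x. x \<in> X \<Longrightarrow> g x \<in> ball 0 1"
      for g :: "'b::topological_space \<Rightarrow> complex" and X
      by (rule continuous_on_compose2[OF K_cont that(1)]) (use that in blast)
    have "compact C" unfolding C_def
      by (rule compact_continuous_image[OF continuous_on_subset[OF K_cont]]) (use r in auto)
    hence "closed C" by (rule compact_imp_closed)
    have "C \<subseteq> V" using r by (auto simp: C_def)
    have clT: "closed T" unfolding T_def
    proof (intro closed_INT ballI continuous_closed_preimage)
      fix t :: real assume "t \<in> {0..1}"
      show "continuous_on {0..1} (\<lambda>s. \<Gamma> s t)" unfolding \<Gamma>_def
        by (intro continuous_intros K_cont') (use sb ab in auto)
    qed (use \<open>closed C\<close> in auto)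
    have "compact (({0..1} \<times> {0..1}) \<inter> (\<lambda>(s,t). \<Gamma> s t) -` (- V))"
    proof -
      have "continuous_on ({0..1} \<times> {0..1}) (\<lambda>(s,t). \<Gamma> s t)"
        unfolding \<Gamma>_def case_prod_unfold
        by (intro continuous_intros K_cont') (use sb ab in auto)
      from continuous_closed_preimage[OF this closed_Times] open_V
      have "closed (({0..1} \<times> {0..1}) \<inter> (\<lambda>(s,t). \<Gamma> s t) -` (- V))" by auto
      moreover have "bounded (({0..1} \<times> {0..1}) \<inter> (\<lambda>(s,t). \<Gamma> s t) -` (- V))"
        by (rule bounded_subset[OF bounded_Times[of "{0..1::real}" "{0..1::real}"]]) auto
      ultimately show ?thesis by (simp add: compact_eq_bounded_closed)
    qed
    hence "compact B" unfolding B_def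
      by (intro compact_continuous_image continuous_intros)
    hence clB: "closed B" by (rule compact_imp_closed)
    have seg: "closed_segment (K (of_real s * a)) (K (of_real s * b)) = \<Gamma> s ` {0..1}" for s
      unfolding \<Gamma>_def closed_segment_image_interval by (simp add: scaleR_conv_of_real)
    have cover: "{0..1} \<subseteq> T \<union> B"
    proof
      fix s :: real assume s: "s \<in> {0..1}"
      show "s \<in> T \<union> B"
      proof (cases "\<Gamma> s ` {0..1} \<subseteq> V")
        case False
        then obtain t where "t \<in> {0..1}" "\<Gamma> s t \<notin> V" by blast
        hence "s \<in> B" unfolding B_def using s by (intro image_eqI[of _ _ "(s, t)"]) auto
        thus ?thesis ..
      next
        case True
        have "\<Gamma> s t \<in> C" if t: "t \<in> {0..1}" for t
        proof -
          have "cmod (k (\<Gamma> s t)) \<le> max (cmod (of_real s * a)) (cmod (of_real s * b))"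
            by (rule segment_preimage_norm_le[OF sb sb]) (use s ab True t in \<open>auto simp: seg\<close>)
          also have "\<dots> \<le> r" using sc[OF s, of a] sc[OF s, of b] by (auto simp: r_def)
          finally have "k (\<Gamma> s t) \<in> cball 0 r" by simp
          moreover have "\<Gamma> s t = K (k (\<Gamma> s t))" by (rule K_k[symmetric]) (use True t in auto)
          ultimately show ?thesis unfolding C_def by blast
        qed
        thus ?thesis using s by (auto simp: T_def)
      qed
    qed
    have disj: "T \<inter> B \<inter> {0..1} = {}" using \<open>C \<subseteq> V\<close> by (fastforce simp: T_def B_def)
    have "0 \<in> T"
    proof -
      have "\<Gamma> 0 t = K 0" for t by (simp add: \<Gamma>_def algebra_simps)
      moreover have "K 0 \<in> C" by (auto simp: C_def r_def le_max_iff_disj)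
      ultimately show ?thesis by (auto simp: T_def)
    qed
    hence "T \<inter> {0..1} \<noteq> {}" by auto
    hence "B \<inter> {0..1} = {}"
      using connected_Icc[of 0 "1::real"] clT clB cover disj unfolding connected_closed by blast
    moreover have "(1::real) \<in> {0..1}" by simp
    ultimately have "1 \<in> T" using cover by blast
    hence "\<Gamma> 1 ` {0..1} \<subseteq> V" using \<open>C \<subseteq> V\<close> by (auto simp: T_def)
    thus ?thesis using seg[of 1] by simp
  qed
  thus ?thesis unfolding convex_contains_segment by blast
qed

text \<open>
  On the convex set \<open>V\<close> the function \<open>f \<circ> k\<close> has the derivative \<open>f' / K'\<close>, evaluated at \<open>k\<close>.
\<close>

lemma close_to_convex_inj:
  assumes f: "f holomorphic_on ball 0 1"
    and pos: "\<And>z. z \<in> ball 0 1 \<Longrightarrow> 0 < Re (deriv f z / deriv K z)"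
  shows "inj_on f (ball 0 1)"
proof -
  have "inj_on (\<lambda>w. f (k w)) V"
  proof (rule noshiro_warschawski[OF convex_V, where F' = "\<lambda>w. deriv f (k w) / deriv K (k w)"])
    fix w assume w: "w \<in> V"
    have "(f has_field_derivative deriv f (k w)) (at (k w))"
      using f k_in[OF w] by (auto intro: holomorphic_derivI)
    from DERIV_chain2[OF this k_deriv[OF w]]
    show "((\<lambda>w. f (k w)) has_field_derivative deriv f (k w) / deriv K (k w)) (at w)"
      by (simp add: divide_inverse)
    show "0 < Re (deriv f (k w) / deriv K (k w))" by (rule pos[OF k_in[OF w]])
  qed
  hence inj: "inj_on ((\<lambda>w. f (k w)) \<circ> K) (ball 0 1)" by (rule comp_inj_on[OF K_inj])
  show ?thesis
    by (rule inj_on_cong[THEN iffD1, OF _ inj]) (simp add: k_K)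
qed

end

text \<open>
  A primitive \<open>K\<close> of \<open>E\<close> is univalent as \<open>Re K' > 1/2\<close>, and its curvature condition is the starlikeness
  condition on \<open>E\<close>.
\<close>

lemma (in even_starlike) close_to_convex_inj:
  assumes f: "f holomorphic_on ball 0 1"
    and pos: "\<And>z. z \<in> ball 0 1 \<Longrightarrow> 0 < Re (deriv f z / E z)"
  shows "inj_on f (ball 0 1)"
proof -
  obtain K where K: "\<And>z. z \<in> ball 0 1 \<Longrightarrow> (K has_field_derivative E z) (at z)"
    using holomorphic_convex_primitive'[OF convex_ball open_ball hol]
    by (metis at_within_open open_ball)
  have K_hol: "K holomorphic_on ball 0 1"
    unfolding holomorphic_on_open[OF open_ball] using K by blast
  have dK: "deriv K z = E z" if "z \<in> ball 0 1" for z by (rule DERIV_imp_deriv[OF K[OF that]])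
  have ddK: "deriv (deriv K) z = deriv E z" if "z \<in> ball 0 1" for z
    by (rule deriv_cong_ev[OF eventually_mono[OF eventually_nhds_in_open[of "ball 0 1" z]]])
      (use dK that in auto)
  have inj: "inj_on K (ball 0 1)"
  proof (rule noshiro_warschawski[OF convex_ball K])
    show "0 < Re (E z)" if "z \<in> ball 0 1" for z using Re_E[OF that] by linarith
  qed
  obtain k where k: "k holomorphic_on (K ` ball 0 1)"
    "\<And>z. z \<in> ball 0 1 \<Longrightarrow> deriv K z * deriv k (K z) = 1" "\<And>z. z \<in> ball 0 1 \<Longrightarrow> k (K z) = z"
    using holomorphic_has_inverse[OF K_hol open_ball inj] by metis
  interpret convex_function K k
    by unfold_locales (use K_hol k star dK ddK in auto)
  show ?thesis by (rule close_to_convex_inj[OF f]) (use pos dK in simp)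
qed

section \<open>A covering theorem\<close>

lemma norm_has_derivative:
  fixes h :: "real \<Rightarrow> complex"
  assumes "(h has_vector_derivative h') (at t)" "h t \<noteq> 0"
  shows "((\<lambda>t. cmod (h t)) has_real_derivative Re (cnj (h t) * h') / cmod (h t)) (at t)"
proof -
  have alg: "inverse s / 2 * (2 * c) = c / s" for s c :: real
    by (cases "s = 0") (simp_all add: field_simps)
  have s: "(sqrt has_real_derivative inverse (sqrt ((cmod (h t))\<^sup>2)) / 2) (at ((cmod (h t))\<^sup>2))"
    by (rule DERIV_real_sqrt) (use assms(2) in simp)
  have "((\<lambda>t. sqrt ((cmod (h t))\<^sup>2)) has_real_derivative
     inverse (sqrt ((cmod (h t))\<^sup>2)) / 2 * (2 * Re (cnj (h t) * h'))) (at t)"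
    by (rule DERIV_chain2[of sqrt _ "\<lambda>t. (cmod (h t))\<^sup>2" t, OF s norm_square_has_derivative[OF assms(1)]])
  moreover have "inverse (sqrt ((cmod (h t))\<^sup>2)) / 2 * (2 * Re (cnj (h t) * h')) = Re (cnj (h t) * h') / cmod (h t)"
    by (simp only: real_sqrt_abs abs_norm_cancel alg)
  ultimately show ?thesis by (simp only: real_sqrt_abs abs_norm_cancel)
qed

text \<open>
  Otherwise the inverse function would be entire and bounded, but not constant.
\<close>

lemma univalent_image_not_UNIV:
  fixes f :: "complex \<Rightarrow> complex"
  assumes f: "f holomorphic_on ball 0 1" and inj: "inj_on f (ball 0 1)"
  shows "f ` ball 0 1 \<noteq> UNIV"
proof
  assume UN: "f ` ball 0 1 = UNIV"
  obtain k where k: "k holomorphic_on (f ` ball 0 1)" "\<And>z. z \<in> ball 0 1 \<Longrightarrow> k (f z) = z"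
    using holomorphic_has_inverse[OF f open_ball inj] by metis
  have "range k = k ` f ` ball 0 1" by (simp add: UN)
  also have "\<dots> = ball 0 1" using k(2) by (force simp: image_image)
  finally have "bounded (range k)" by simp
  hence "k constant_on UNIV" using Liouville_theorem k(1) UN by simp
  hence "k (f 0) = k (f (1/2))" by (auto simp: constant_on_def)
  thus False using k(2)[of 0] k(2)[of "1/2"] by (simp add: norm_divide)
qed

text \<open>
  Let \<open>w\<close> be a frontier point nearest to \<open>f 0\<close>. The half-open segment from \<open>f 0\<close> to \<open>w\<close> lies in the image;
  its preimage \<open>h\<close> starts at 0 and leaves every disc of radius \<open>r < 1\<close>. With \<open>\<Lambda>\<close> the indefinite integral of
  \<open>l\<close>, the derivative of \<open>\<Lambda>(\<bar>h\<bar>)\<close> is at most \<open>\<bar>f'(h)\<bar> \<bar>h'\<bar> = \<bar>w - f 0\<bar>\<close>, whence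
  \<open>\<Lambda>(r) \<le> \<bar>w - f 0\<bar>\<close>.
\<close>

lemma covering_radius:
  fixes f :: "complex \<Rightarrow> complex" and l :: "real \<Rightarrow> real"
  assumes f: "f holomorphic_on ball 0 1" and inj: "inj_on f (ball 0 1)"
    and l_cont: "continuous_on {0..<1} l" and l_pos: "\<And>t. 0 \<le> t \<Longrightarrow> t < 1 \<Longrightarrow> 0 < l t"
    and l_le: "\<And>z. z \<in> ball 0 1 \<Longrightarrow> l (cmod z) \<le> cmod (deriv f z)"
    and r: "0 \<le> r" "r < 1"
  shows "integral {0..r} l \<le> infdist (f 0) (frontier (f ` ball 0 1))"
proof -
  let ?V = "f ` ball 0 1"
  obtain k where k: "k holomorphic_on ?V" "\<And>z. z \<in> ball 0 1 \<Longrightarrow> deriv f z * deriv k (f z) = 1"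
    "\<And>z. z \<in> ball 0 1 \<Longrightarrow> k (f z) = z"
    using holomorphic_has_inverse[OF f open_ball inj] by metis
  have opV: "open ?V" by (rule open_mapping_thm3[OF f open_ball inj])
  have f0: "f 0 \<in> ?V" by simp
  have "frontier ?V \<noteq> {}"
    using univalent_image_not_UNIV[OF f inj] f0 by (simp add: frontier_eq_empty)
  then obtain w where w: "w \<in> frontier ?V" "infdist (f 0) (frontier ?V) = dist (f 0) w"
    using infdist_attains_inf[of "frontier ?V" "f 0"] by auto
  have wV: "w \<notin> ?V" using w(1) opV by (simp add: frontier_def interior_open)
  define d where "d = w - f 0"
  have disj: "ball (f 0) (cmod d) \<inter> frontier ?V = {}"
  proof (rule ccontr)
    assume "ball (f 0) (cmod d) \<inter> frontier ?V \<noteq> {}"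
    then obtain y where "y \<in> frontier ?V" "dist (f 0) y < cmod d" by auto
    thus False using infdist_le[of y "frontier ?V" "f 0"] w(2) by (simp add: d_def dist_norm norm_minus_commute)
  qed
  have d: "d \<noteq> 0" using wV f0 by (auto simp: d_def)
  have sub: "ball (f 0) (cmod d) \<subseteq> ?V"
  proof (rule ccontr)
    assume "\<not> ball (f 0) (cmod d) \<subseteq> ?V"
    hence "ball (f 0) (cmod d) - ?V \<noteq> {}" by blast
    moreover have "f 0 \<in> ball (f 0) (cmod d)" using d by simp
    hence "ball (f 0) (cmod d) \<inter> ?V \<noteq> {}" using f0 by blast
    ultimately show False using connected_Int_frontier[OF connected_ball] disj by blast
  qed
  have in_V: "f 0 + of_real t * d \<in> ?V" if "0 \<le> t" "t < 1" for t :: real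
    by (rule subsetD[OF sub]) (use that d in \<open>simp add: dist_norm norm_mult\<close>)
  define h where "h t = k (f 0 + of_real t * d)" for t :: real
  have h_in: "h t \<in> ball 0 1" and f_h: "f (h t) = f 0 + of_real t * d" if "0 \<le> t" "t < 1" for t
    using in_V[OF that] k(3) by (auto simp: h_def)
  have h0: "h 0 = 0" by (simp add: h_def k(3))
  have f'_pos: "0 < cmod (deriv f z)" if "z \<in> ball 0 1" for z
    by (rule less_le_trans[OF l_pos l_le]) (use that in auto)
  define h' where "h' t = inverse (deriv f (h t)) * d" for t
  have dh: "(h has_vector_derivative h' t) (at t)" if "0 \<le> t" "t < 1" for t
  proof -
    have "deriv k (f 0 + of_real t * d) = inverse (deriv f (h t))"
      using k(2)[OF h_in[OF that]] f'_pos[OF h_in[OF that]] f_h[OF that] by (simp add: field_simps)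
    thus ?thesis unfolding h_def[abs_def] h'_def
      using has_vector_derivative_on_line[OF holomorphic_derivI[OF k(1) opV in_V[OF that]]]
      by (simp add: h_def)
  qed
  have h_cont: "continuous_on {0..<1} h"
    by (intro continuous_at_imp_continuous_on ballI has_vector_derivative_continuous[OF dh]) auto
  define \<Lambda> where "\<Lambda> x = integral {0..x} l" for x
  have l_cont': "continuous_on {0..b} l" if "b < 1" for b
    by (rule continuous_on_subset[OF l_cont]) (use that in auto)
  have \<Lambda>_deriv: "(\<Lambda> has_real_derivative l x) (at x)" if x: "0 < x" "x < 1" for x
  proof -
    define b where "b = (x + 1) / 2"
    have b: "x < b" "b < 1" using x by (auto simp: b_def)
    have "(\<Lambda> has_real_derivative l x) (at x within {0..b})"
      unfolding \<Lambda>_def by (rule integral_has_real_derivative[OF l_cont'[OF b(2)]]) (use x b in auto)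
    thus ?thesis using at_within_interior[of x "{0..b}"] x b by simp
  qed
  have \<Lambda>_cont: "continuous_on {0..<1} \<Lambda>"
  proof -
    have "continuous (at x within {0..<1}) \<Lambda>" if x: "x \<in> {0..<1}" for x
    proof -
      define b where "b = (x + 1) / 2"
      have b: "x < b" "b < 1" using x by (auto simp: b_def)
      have "continuous_on {0..b} \<Lambda>" unfolding \<Lambda>_def
        by (intro indefinite_integral_continuous_1 integrable_continuous_real l_cont' b)
      hence "continuous (at x within {0..b}) \<Lambda>"
        using x b by (simp add: continuous_on_eq_continuous_within)
      moreover have "at x within {0..b} = at x within {0..<1}"
        by (rule at_within_nhd[of _ "{..<b}"]) (use b in auto)
      ultimately show ?thesis by simp
    qed
    thus ?thesis by (simp add: continuous_on_eq_continuous_within)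
  qed
  have growth: "\<Lambda> (cmod (h t)) \<le> cmod d" if t: "0 \<le> t" "t < 1" for t
  proof (cases "t = 0")
    case True thus ?thesis by (simp add: h0 \<Lambda>_def)
  next
    case False
    have "0 * cmod d - \<Lambda> (cmod (h 0)) \<le> t * cmod d - \<Lambda> (cmod (h t))"
    proof (rule DERIV_nonneg_imp_increasing_open[where f = "\<lambda>t. t * cmod d - \<Lambda> (cmod (h t))"])
      show "continuous_on {0..t} (\<lambda>t. t * cmod d - \<Lambda> (cmod (h t)))"
      proof (intro continuous_intros continuous_on_compose2[OF \<Lambda>_cont])
        show "continuous_on {0..t} h" by (rule continuous_on_subset[OF h_cont]) (use t in auto)
        show "(\<lambda>x. cmod (h x)) ` {0..t} \<subseteq> {0..<1}" using h_in t by auto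
      qed
    next
      fix x assume x: "0 < x" "x < t"
      have x1: "0 \<le> x" "x < 1" using x t by auto
      have hx: "h x \<noteq> 0" using f_h[OF x1] x d by auto
      define \<rho> where "\<rho> = cmod (h x)"
      have \<rho>: "0 < \<rho>" "\<rho> < 1" using hx h_in[OF x1] by (auto simp: \<rho>_def)
      define m where "m = Re (cnj (h x) * h' x) / \<rho>"
      have dn: "((\<lambda>x. cmod (h x)) has_real_derivative m) (at x)"
        unfolding m_def \<rho>_def by (rule norm_has_derivative[OF dh[OF x1] hx])
      have dA: "((\<lambda>t. t * cmod d - \<Lambda> (cmod (h t))) has_real_derivative (cmod d - l \<rho> * m)) (at x)"
      proof -
        have "((\<lambda>t. \<Lambda> (cmod (h t))) has_real_derivative l \<rho> * m) (at x)"
          using \<Lambda>_deriv[OF \<rho>] dn unfolding \<rho>_def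
          by (rule DERIV_chain2[of \<Lambda> _ "\<lambda>t. cmod (h t)" x])
        from DERIV_diff[OF DERIV_cmult_right[OF DERIV_ident, of "cmod d"] this]
        show ?thesis by simp
      qed
      have "Re (cnj (h x) * h' x) \<le> \<rho> * cmod (h' x)"
        using complex_Re_le_cmod[of "cnj (h x) * h' x"] by (simp add: norm_mult \<rho>_def)
      hence "m \<le> cmod (h' x)" using \<rho> by (simp add: m_def divide_le_eq mult.commute)
      hence "l \<rho> * m \<le> l \<rho> * cmod (h' x)"
        using l_pos[of \<rho>] \<rho> by (intro mult_left_mono) auto
      also have "\<dots> \<le> cmod (deriv f (h x)) * cmod (h' x)"
        using l_le[OF h_in[OF x1]] by (intro mult_right_mono) (auto simp: \<rho>_def)
      also have "\<dots> = cmod d"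
        using f'_pos[OF h_in[OF x1]] by (simp add: h'_def norm_mult norm_inverse)
      finally show "\<exists>y. ((\<lambda>t. t * cmod d - \<Lambda> (cmod (h t))) has_real_derivative y) (at x) \<and> 0 \<le> y"
        using dA by (intro exI[of _ "cmod d - l \<rho> * m"]) simp
    qed (use t False in auto)
    moreover have "\<Lambda> (cmod (h 0)) = 0" by (simp add: h0 \<Lambda>_def)
    moreover have "t * cmod d \<le> cmod d" using t by (simp add: mult_left_le_one_le)
    ultimately show ?thesis by simp
  qed
  \<comment> \<open>otherwise \<open>w\<close> would lie in the compact set \<open>f ` cball 0 r\<close>, but \<open>w\<close> is not a value of \<open>f\<close>\<close>
  have "\<exists>t. 0 \<le> t \<and> t < 1 \<and> r < cmod (h t)"
  proof (rule ccontr)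
    assume "\<nexists>t. 0 \<le> t \<and> t < 1 \<and> r < cmod (h t)"
    hence small: "h t \<in> cball 0 r" if "0 \<le> t" "t < 1" for t using that by force
    have "compact (f ` cball 0 r)"
      by (rule compact_continuous_image[OF continuous_on_subset[OF holomorphic_on_imp_continuous_on[OF f]]])
        (use r in auto)
    hence cl: "closed (f ` cball 0 r)" by (rule compact_imp_closed)
    have lim: "((\<lambda>t. f 0 + of_real t * d) \<longlongrightarrow> f 0 + of_real 1 * d) (at_left (1::real))"
      by (intro tendsto_intros)
    have ev: "\<forall>\<^sub>F t in at_left (1::real). f 0 + of_real t * d \<in> f ` cball 0 r"
      using eventually_at_left_real[of 0 "1::real", OF zero_less_one]
    proof eventually_elim
      case (elim t)
      thus ?case using f_h[of t] small[of t] by (metis greaterThanLessThan_iff image_eqI less_imp_le)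
    qed
    have "f 0 + of_real 1 * d \<in> f ` cball 0 r"
      by (rule Lim_in_closed_set[OF cl ev _ lim]) simp
    hence "w \<in> ?V" using r by (auto simp: d_def)
    thus False using wV by simp
  qed
  then obtain t where t: "0 \<le> t" "t < 1" "r < cmod (h t)" by blast
  have "\<Lambda> r \<le> \<Lambda> (cmod (h t))"
    unfolding \<Lambda>_def
  proof (rule integral_subset_le)
    show "l integrable_on {0..r}" "l integrable_on {0..cmod (h t)}"
      using l_cont' r h_in[OF t(1,2)] by (auto intro!: integrable_continuous_real)
    show "\<forall>x\<in>{0..cmod (h t)}. 0 \<le> l x"
      using less_imp_le[OF l_pos] h_in[OF t(1,2)] by simp
  qed (use t in auto)
  also have "\<dots> \<le> cmod d" by (rule growth[OF t(1,2)])
  also have "\<dots> = infdist (f 0) (frontier ?V)" unfolding w(2) by (simp add: d_def dist_norm norm_minus_commute)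
  finally show ?thesis by (simp add: \<Lambda>_def)
qed

section \<open>The product representation of the derivative\<close>

text \<open>
  A logarithmic derivative has a pole at each zero. At a pole the value of \<open>remove_sings\<close> is 0, so this
  lemma excludes zeros of a function in \<open>starlike_half\<close> other than the origin.
\<close>

lemma log_deriv_pole_at_zero:
  fixes g :: "complex \<Rightarrow> complex"
  assumes g: "g holomorphic_on ball 0 1" and g'0: "deriv g 0 \<noteq> 0"
    and z0: "z0 \<in> ball 0 1" "z0 \<noteq> 0" "g z0 = 0"
  shows "is_pole (\<lambda>z. z * deriv g z / g z) z0"
proof -
  have an: "g analytic_on {z0}"
    using g z0 by (auto intro: holomorphic_on_imp_analytic_at)
  have F: "(\<lambda>w. g (z0 + w)) has_laurent_expansion fps_to_fls (fps_expansion g z0)"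
    by (intro has_laurent_expansion_fps analytic_at_imp_has_fps_expansion an)
  have "fps_expansion g z0 \<noteq> 0"
  proof
    assume 0: "fps_expansion g z0 = 0"
    have "(deriv ^^ n) g z0 = 0" for n
      using arg_cong[OF 0, of "\<lambda>F. fps_nth F n"] by (simp add: fps_expansion_def)
    hence "g w = 0" if "w \<in> ball 0 1" for w
      using holomorphic_fun_eq_0_on_connected[OF g _ _ _ z0(1) that] by simp
    hence "deriv g 0 = deriv (\<lambda>_. 0) 0"
      by (intro deriv_cong_ev eventually_mono[OF eventually_nhds_in_open[of "ball 0 1" 0]]) auto
    thus False using g'0 by simp
  qed
  moreover have "g \<midarrow>z0\<rightarrow> 0"
    using isContD[OF analytic_at_imp_isCont[OF an]] z0(3) by simp
  ultimately have pole: "is_pole (\<lambda>z. deriv g z / g z) z0"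
    using is_pole_deriv_divide_iff[OF F] by simp
  have "filterlim (\<lambda>z. z * (deriv g z / g z)) at_infinity (at z0)"
    by (rule tendsto_mult_filterlim_at_infinity[OF tendsto_ident_at z0(2)])
      (use pole in \<open>simp add: is_pole_def\<close>)
  thus ?thesis by (simp add: is_pole_def)
qed

text \<open>
  With \<open>g(z) = z e(z)\<close> the factor is \<open>E(z) = e(z) e(- z)\<close>. Its logarithmic derivative adds up the ones of
  \<open>g\<close> at \<open>z\<close> and at \<open>- z\<close>: \<open>1 + z E'(z) / E(z)\<close> is the sum of the two values of \<open>z g' / g\<close> minus 1, and each
  of them has real part greater than \<open>1/2\<close>.
\<close>

lemma class_Ks_factorization:
  assumes f: "f \<in> class_Ks \<phi>" and \<phi>0: "\<phi> 0 = 1"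
  obtains E \<omega> where "even_starlike E"
    "\<omega> holomorphic_on ball 0 1" "\<And>z. z \<in> ball 0 1 \<Longrightarrow> cmod (\<omega> z) < 1" "\<omega> 0 = 0"
    "\<And>z. z \<in> ball 0 1 \<Longrightarrow> deriv f z = E z * \<phi> (\<omega> z)"
proof -
  from f obtain g where fA: "f \<in> class_A" and gS: "g \<in> starlike_half"
    and sub: "remove_sings (\<lambda>z. - (z\<^sup>2 * deriv f z / (g z * g (- z)))) \<prec>\<^sub>s \<phi>"
    by (auto simp: class_Ks_def)
  from sub obtain \<omega> where \<omega>: "\<omega> holomorphic_on ball 0 1" "\<omega> \<in> ball 0 1 \<rightarrow> ball 0 1" "\<omega> 0 = 0"
    "\<And>z. z \<in> ball 0 1 \<Longrightarrow> remove_sings (\<lambda>z. - (z\<^sup>2 * deriv f z / (g z * g (- z)))) z = \<phi> (\<omega> z)"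
    unfolding subordinate_def by blast
  have g: "g holomorphic_on ball 0 1" "g 0 = 0" "deriv g 0 = 1"
    using gS by (auto simp: starlike_half_def class_A_def fps_expansion_def)
  have fh: "f holomorphic_on ball 0 1" "deriv f 0 = 1"
    using fA by (auto simp: class_A_def fps_expansion_def)
  have g_star: "Re (remove_sings (\<lambda>z. z * deriv g z / g z) z) > 1 / 2" if "z \<in> ball 0 1" for z
    using gS that by (auto simp: starlike_half_def)
  have g_nz: "g z \<noteq> 0" if "z \<in> ball 0 1" "z \<noteq> 0" for z
  proof
    assume "g z = 0"
    from log_deriv_pole_at_zero[OF g(1) _ that this] g(3)
    have "remove_sings (\<lambda>z. z * deriv g z / g z) z = 0" by simp
    thus False using g_star[OF that(1)] by simp
  qed
  obtain e where e: "e holomorphic_on ball 0 1" "\<And>z. z \<in> ball 0 1 \<Longrightarrow> g z = z * e z" "e 0 = 1"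
    using divide_zero_holomorphic[OF g(1,2)] g(3) by metis
  have e_nz: "e z \<noteq> 0" if "z \<in> ball 0 1" for z
    using g_nz[OF that] e(2)[OF that] e(3) by (cases "z = 0") auto
  have de: "(e has_field_derivative deriv e z) (at z)" if "z \<in> ball 0 1" for z
    using e(1) that by (auto intro: holomorphic_derivI)
  have dg: "deriv g z = e z + z * deriv e z" if z: "z \<in> ball 0 1" for z
  proof -
    have "((\<lambda>z. z * e z) has_field_derivative e z + z * deriv e z) (at z)"
      using de[OF z] by (auto intro!: derivative_eq_intros)
    hence "(g has_field_derivative e z + z * deriv e z) (at z)"
      by (rule has_field_derivative_transform_within_open[of _ _ _ "ball 0 1"]) (use e(2) z in auto)
    thus ?thesis by (rule DERIV_imp_deriv)
  qed
  have an: "h analytic_on {z}" if "h holomorphic_on ball 0 1" "z \<in> ball 0 1" for h z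
    using that by (auto intro: holomorphic_on_imp_analytic_at)
  have an_uminus: "(\<lambda>z. h (- z)) analytic_on {z}" if "h holomorphic_on ball 0 1" "z \<in> ball 0 1" for h z
  proof -
    have "h \<circ> uminus analytic_on {z}"
      by (rule analytic_on_compose_gen[OF _ an[OF that(1), of "-z"]]) (use that in \<open>auto intro!: analytic_intros\<close>)
    thus ?thesis by (simp add: o_def)
  qed
  have half: "1/2 < Re (1 + z * deriv e z / e z)" if z: "z \<in> ball 0 1" for z
  proof (cases "z = 0")
    case False
    have "(\<lambda>z. z * deriv g z / g z) analytic_on {z}"
      by (intro analytic_intros an z g holomorphic_deriv) (use g_nz z False in auto)
    from remove_sings_at_analytic[OF this] g_star[OF z]
    have "1/2 < Re (z * deriv g z / g z)" by simp
    also have "z * deriv g z / g z = 1 + z * deriv e z / e z"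
      unfolding dg[OF z] e(2)[OF z] using e_nz[OF z] False by (simp add: field_simps)
    finally show ?thesis .
  qed simp
  define E where "E z = e z * e (- z)" for z
  have dE: "deriv E z = deriv e z * e (- z) - e z * deriv e (- z)" if z: "z \<in> ball 0 1" for z
  proof -
    have "((\<lambda>z. e (- z)) has_field_derivative deriv e (- z) * (- 1)) (at z)"
      by (rule DERIV_chain2[OF de]) (use z in \<open>auto intro!: derivative_eq_intros\<close>)
    from DERIV_mult[OF de[OF z] this]
    have "(E has_field_derivative deriv e z * e (- z) - e z * deriv e (- z)) (at z)"
      by (simp add: E_def[abs_def] algebra_simps)
    thus ?thesis by (rule DERIV_imp_deriv)
  qed
  have E_nz: "E z \<noteq> 0" if "z \<in> ball 0 1" for z using e_nz[of z] e_nz[of "-z"] that by (simp add: E_def)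
  have star: "even_starlike E"
  proof
    have "e \<circ> uminus holomorphic_on ball 0 1"
      by (rule holomorphic_on_compose_gen[OF _ e(1)]) (auto intro!: holomorphic_intros)
    thus "E holomorphic_on ball 0 1" unfolding E_def[abs_def] o_def by (intro holomorphic_intros e(1))
    show "E 0 = 1" by (simp add: E_def e(3))
    fix z :: complex assume z: "z \<in> ball 0 1"
    hence mz: "- z \<in> ball 0 1" by simp
    show "E z \<noteq> 0" by (rule E_nz[OF z])
    show "E (- z) = E z" by (simp add: E_def mult.commute)
    have "1 + z * deriv E z / E z = (1 + z * deriv e z / e z) + (1 + (- z) * deriv e (- z) / e (- z)) - 1"
      unfolding dE[OF z] E_def using e_nz[OF z] e_nz[OF mz] by (simp add: field_simps)
    thus "0 < Re (1 + z * deriv E z / E z)" using half[OF z] half[OF mz] by simp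
  qed
  have "deriv f z = E z * \<phi> (\<omega> z)" if z: "z \<in> ball 0 1" for z
  proof (cases "z = 0")
    case True thus ?thesis using fh(2) \<omega>(3) \<phi>0 by (simp add: E_def e(3))
  next
    case False
    have mz: "- z \<in> ball 0 1" using z by simp
    have "(\<lambda>z. - (z\<^sup>2 * deriv f z / (g z * g (- z)))) analytic_on {z}"
      by (intro analytic_intros an an_uminus z g(1) fh(1) holomorphic_deriv) (use g_nz[OF z] g_nz[OF mz] False in auto)
    from remove_sings_at_analytic[OF this] \<omega>(4)[OF z]
    have "\<phi> (\<omega> z) = - (z\<^sup>2 * deriv f z / (g z * g (- z)))" by simp
    also have "\<dots> = deriv f z / E z"
      unfolding e(2)[OF z] e(2)[OF mz] E_def using e_nz[OF z] e_nz[OF mz] False by (simp add: field_simps power2_eq_square)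
    finally show ?thesis using E_nz[OF z] by simp
  qed
  thus ?thesis using that[OF star \<omega>(1) _ \<omega>(3)] \<omega>(2) by (auto simp: Pi_iff)
qed


section \<open>The functions L and R\<close>

lemma negligible_subset_1: "X \<subseteq> {1::real} \<Longrightarrow> negligible X"
  using negligible_subset[of "{1::real}" X] by simp

lemma one_plus_square_pos: "0 < 1 + (t::real)\<^sup>2"
  by (rule add_pos_nonneg) auto

text \<open>
  The properties of a Ma-Minda function whose modulus is minimal on the negative axis that matter
  for the comparison of \<open>R\<close> and \<open>L\<close>.
\<close>

locale minimal_on_negative_axis =
  fixes \<phi> :: "complex \<Rightarrow> complex"
  assumes hol: "\<phi> holomorphic_on ball 0 1" and \<phi>0: "\<phi> 0 = 1"
    and Re_pos: "\<And>z. z \<in> ball 0 1 \<Longrightarrow> 0 < Re (\<phi> z)"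
    and min: "\<And>r. 0 < r \<Longrightarrow> r < 1 \<Longrightarrow>
           \<phi> (- of_real r) = of_real (INF z\<in>sphere 0 r. cmod (\<phi> z))"
begin

text \<open>
  The minimum principle: \<open>\<phi>\<close> has no zeros, so the maximum principle applies to \<open>1 / \<phi>\<close>.
\<close>

lemma Re_le_norm:
  assumes r: "0 \<le> r" "r < 1" and z: "cmod z \<le> r"
  shows "Re (\<phi> (- of_real r)) \<le> cmod (\<phi> z)"
proof (cases "r = 0")
  case True thus ?thesis using z \<phi>0 by simp
next
  case False
  define I where "I = Re (\<phi> (- of_real r))"
  have I: "I = (INF z\<in>sphere 0 r. cmod (\<phi> z))" using min[of r] r False by (simp add: I_def)
  have I_pos: "0 < I" unfolding I_def by (rule Re_pos) (use r in simp)
  have nz: "\<phi> z \<noteq> 0" if "z \<in> ball 0 1" for z using Re_pos[OF that] by auto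
  have sub: "cball 0 r \<subseteq> ball (0::complex) 1" using r by auto
  have holi: "(\<lambda>z. inverse (\<phi> z)) holomorphic_on ball 0 1"
    by (intro holomorphic_intros hol nz)
  have "norm (inverse (\<phi> z)) \<le> inverse I"
  proof (rule maximum_modulus_frontier[of "\<lambda>z. inverse (\<phi> z)" "cball 0 r"])
    show "(\<lambda>z. inverse (\<phi> z)) holomorphic_on interior (cball 0 r)"
      by (rule holomorphic_on_subset[OF holi]) (use sub interior_subset in blast)
    show "continuous_on (closure (cball 0 r)) (\<lambda>z. inverse (\<phi> z))"
      by (rule continuous_on_subset[OF holomorphic_on_imp_continuous_on[OF holi]]) (use sub in simp)
    show "norm (inverse (\<phi> y)) \<le> inverse I" if "y \<in> frontier (cball 0 r)" for y
    proof -
      have "I \<le> cmod (\<phi> y)" unfolding I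
        by (rule cINF_lower) (use that in \<open>auto intro!: bdd_belowI[of _ 0]\<close>)
      thus ?thesis using I_pos by (simp add: norm_inverse le_imp_inverse_le)
    qed
  qed (use z in auto)
  moreover have "0 < cmod (\<phi> z)" using nz[of z] z r by simp
  ultimately show ?thesis using I_pos unfolding I_def[symmetric]
    by (simp add: norm_inverse)
qed

definition l where "l t = Re (\<phi> (- of_real t)) / (1 + t\<^sup>2)"

lemma l_pos: "0 \<le> t \<Longrightarrow> t < 1 \<Longrightarrow> 0 < l t"
  unfolding l_def using one_plus_square_pos[of t] by (intro divide_pos_pos Re_pos) auto

lemma l_le_1:
  assumes "0 \<le> t" "t < 1" shows "l t \<le> 1"
proof -
  have "l t \<le> Re (\<phi> (- of_real t)) / 1"
    unfolding l_def using Re_pos[of "- of_real t"] assms one_plus_square_pos[of t] by (intro divide_left_mono) auto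
  also have "\<dots> \<le> cmod (\<phi> 0)" using Re_le_norm[OF assms, of 0] assms by simp
  finally show ?thesis by (simp add: \<phi>0)
qed

lemma l_cont: "continuous_on {0..<1} l"
proof -
  have "continuous_on {0..<1} (\<lambda>t::real. \<phi> (- of_real t))"
    by (rule continuous_on_compose2[OF holomorphic_on_imp_continuous_on[OF hol]])
      (auto intro!: continuous_intros)
  thus ?thesis unfolding l_def[abs_def]
    by (intro continuous_intros) (auto simp: add_nonneg_eq_0_iff)
qed

text \<open>
  The value of \<open>\<phi>\<close> at \<open>- 1\<close> is arbitrary, so \<open>l\<close> need not be continuous at 1; it is bounded and
  continuous on the half-open interval.
\<close>

lemma l_integrable: "l integrable_on {0..1}"
proof -
  have "l integrable_on {0..<1}"
  proof (rule measurable_bounded_by_integrable_imp_integrable)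
    show "l \<in> borel_measurable (lebesgue_on {0..<1})"
      by (rule continuous_imp_measurable_on_sets_lebesgue[OF l_cont]) auto
    have "(\<lambda>_. 1::real) integrable_on {0..1::real}" by (rule integrable_const_ivl)
    thus "(\<lambda>_. 1::real) integrable_on {0..<1::real}"
      by (rule integrable_spike_set[of _ "{0..1}"]) (auto intro!: negligible_subset_1)
    show "norm (l x) \<le> 1" if "x \<in> {0..<1}" for x
      using l_pos[of x] l_le_1[of x] that by simp
  qed auto
  thus ?thesis
    by (rule integrable_spike_set) (auto intro!: negligible_subset_1)
qed

lemma L_int_eq: "L_int \<phi> r = integral {0..r} l"
  by (simp add: L_int_def l_def[abs_def])

text \<open>
  By continuity of the indefinite integral, \<open>L(1)\<close> is the limit of \<open>L(r)\<close> for \<open>r < 1\<close>.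
\<close>

lemma L_int_1_le:
  assumes "\<And>r. 0 \<le> r \<Longrightarrow> r < 1 \<Longrightarrow> L_int \<phi> r \<le> c"
  shows "L_int \<phi> 1 \<le> c"
proof -
  have "continuous_on {0..1} (\<lambda>r. integral {0..r} l)"
    by (rule indefinite_integral_continuous_1[OF l_integrable])
  hence "((\<lambda>r. integral {0..r} l) \<longlongrightarrow> integral {0..1} l) (at 1 within {0..1})"
    by (simp add: continuous_on_def)
  hence "((\<lambda>r. integral {0..r} l) \<longlongrightarrow> integral {0..1} l) (at_left 1)"
    by (simp add: at_within_Icc_at_left)
  moreover have "\<forall>\<^sub>F r in at_left (1::real). integral {0..r} l \<le> c"
    using eventually_at_left_real[of 0 "1::real", OF zero_less_one]
    by eventually_elim (use assms in \<open>auto simp: L_int_eq\<close>)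
  ultimately show ?thesis unfolding L_int_eq by (rule tendsto_upperbound) simp
qed

lemma L_int_1_bounds: "0 < L_int \<phi> 1" "L_int \<phi> 1 \<le> 1"
proof -
  have l_int: "l integrable_on {a..b}" if "0 \<le> a" "b \<le> 1" for a b
    by (rule integrable_subinterval_real[OF l_integrable]) (use that in auto)
  show "L_int \<phi> 1 \<le> 1"
  proof (rule L_int_1_le)
    fix r :: real assume r: "0 \<le> r" "r < 1"
    have "integral {0..r} l \<le> integral {0..r} (\<lambda>_. 1)"
      by (rule integral_le) (use r l_int l_le_1 in auto)
    thus "L_int \<phi> r \<le> 1" using r by (simp add: L_int_eq)
  qed
  define c where "c = Re (\<phi> (- of_real (1/2))) / 2"
  have c: "0 < c" unfolding c_def by (intro divide_pos_pos Re_pos) (auto simp: norm_divide)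
  have c_le: "c \<le> l t" if t: "t \<in> {0..1/2}" for t
  proof -
    have "Re (\<phi> (- of_real (1/2))) \<le> cmod (\<phi> (- of_real t))"
      by (rule Re_le_norm) (use t in auto)
    also have "\<dots> = Re (\<phi> (- of_real t))"
    proof (cases "t = 0")
      case False
      define I where "I = (INF z\<in>sphere 0 t. cmod (\<phi> z))"
      have "\<phi> (- of_real t) = of_real I" using min[of t] t False by (simp add: I_def)
      moreover have "0 < Re (\<phi> (- of_real t))" by (rule Re_pos) (use t in auto)
      ultimately show ?thesis by simp
    qed (simp add: \<phi>0)
    finally have "Re (\<phi> (- of_real (1/2))) \<le> Re (\<phi> (- of_real t))" .
    moreover have "1 + t\<^sup>2 \<le> 2" using t power_le_one[of t 2] by simp
    moreover have "0 < Re (\<phi> (- of_real t))" by (rule Re_pos) (use t in auto)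
    ultimately show ?thesis unfolding c_def l_def
      by (intro frac_le) (auto simp: add_pos_nonneg)
  qed
  have "0 < c * (1/2)" using c by simp
  also have "\<dots> = integral {0..1/2::real} (\<lambda>_. c)" by simp
  also have "\<dots> \<le> integral {0..1/2} l"
    by (rule integral_le) (use l_int c_le in auto)
  also have "\<dots> \<le> integral {0..1/2} l + integral {1/2..1} l"
  proof -
    have "integral {1/2..1} l = integral {1/2..<1} l"
      by (rule integral_spike_set) (auto intro!: negligible_subset_1)
    moreover have "0 \<le> integral {1/2..<1} l"
    proof (rule integral_nonneg)
      show "l integrable_on {1/2..<1}"
        by (rule integrable_spike_set[OF l_int[of "1/2" 1]]) (auto intro!: negligible_subset_1)
      show "0 \<le> l x" if "x \<in> {1/2..<1}" for x using l_pos[of x] that by simp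
    qed
    ultimately show ?thesis by simp
  qed
  also have "\<dots> = integral {0..1} l"
    by (rule Henstock_Kurzweil_Integration.integral_combine[OF _ _ l_integrable]) auto
  finally show "0 < L_int \<phi> 1" by (simp add: L_int_eq)
qed

definition R_density where "R_density t = majorant \<phi> t / (1 - t\<^sup>2)"

lemma R_int_eq: "R_int \<phi> r = integral {0..r} R_density"
  by (simp add: R_int_def R_density_def[abs_def])

lemma majorant_ge_1:
  assumes "0 \<le> t" "t < 1" shows "1 \<le> majorant \<phi> t"
proof -
  have "(\<Sum>n<1. cmod (taylor_coeff \<phi> n) * t ^ n) \<le> majorant \<phi> t"
    unfolding majorant_def by (rule sum_le_suminf[OF taylor_summable[OF hol assms]]) (use assms in auto)
  thus ?thesis by (simp add: fps_expansion_def \<phi>0)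
qed

lemma R_density_cont: "b < 1 \<Longrightarrow> continuous_on {0..b} R_density"
proof -
  assume b: "b < 1"
  have "isCont (majorant \<phi>) t" if t: "t \<in> {0..b}" for t
    unfolding majorant_def[abs_def]
    by (rule isCont_powser[of _ "(t + 1) / 2"]) (use t b taylor_summable[OF hol, of "(t + 1) / 2"] in auto)
  hence "continuous_on {0..b} (majorant \<phi>)"
    by (intro continuous_at_imp_continuous_on) auto
  moreover have "1 - t\<^sup>2 \<noteq> 0" if "t \<in> {0..b}" for t
    using that b power_less_one_iff[of t 2] by auto
  ultimately show ?thesis unfolding R_density_def[abs_def] by (intro continuous_intros) auto
qed

text \<open>
  The first bound has a divergent integral, so \<open>R\<close> is unbounded; the second one makes \<open>R\<close> strictly
  increasing.
\<close>

lemma R_density_ge: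
  assumes t: "0 \<le> t" "t < 1" shows "1 / (2 * (1 - t)) \<le> R_density t" "1 \<le> R_density t"
proof -
  have t2: "t\<^sup>2 < 1" using t by (simp add: power_less_one_iff)
  have m: "1 \<le> majorant \<phi> t" by (rule majorant_ge_1[OF t])
  have "1 - t\<^sup>2 = (1 + t) * (1 - t)" by (simp add: power2_eq_square algebra_simps)
  also have "\<dots> \<le> 2 * (1 - t)" using t by (intro mult_right_mono) auto
  finally show "1 / (2 * (1 - t)) \<le> R_density t"
    unfolding R_density_def by (intro frac_le) (use m t2 in auto)
  have "1 - t\<^sup>2 \<le> majorant \<phi> t" using m zero_le_power2[of t] by linarith
  thus "1 \<le> R_density t" unfolding R_density_def using t2 by simp
qed

lemma R_density_integrable: "0 \<le> a \<Longrightarrow> b < 1 \<Longrightarrow> R_density integrable_on {a..b}"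
  by (rule integrable_continuous_real, rule continuous_on_subset[OF R_density_cont]) auto

lemma R_int_mono:
  assumes "0 \<le> s" "s \<le> r" "r < 1"
  shows "R_int \<phi> s + (r - s) \<le> R_int \<phi> r"
proof -
  have "R_int \<phi> r = R_int \<phi> s + integral {s..r} R_density"
    unfolding R_int_eq using assms
    by (intro Henstock_Kurzweil_Integration.integral_combine[symmetric] R_density_integrable) auto
  moreover have "integral {s..r} (\<lambda>_. 1) \<le> integral {s..r} R_density"
    by (rule integral_le) (use assms R_density_ge R_density_integrable in auto)
  ultimately show ?thesis using assms by simp
qed

text \<open>
  \<open>R(0) = 0 < L(1) \<le> 1\<close>, and \<open>R\<close> reaches 1 before the end of the interval; the intermediate value
  theorem yields a root, and strict monotonicity its minimality.
\<close>

lemma ex_smallest_root: "\<exists>\<rho>. smallest_root \<phi> \<rho>"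
proof -
  \<comment> \<open>here the antiderivative \<open>- ln (1 - t) / 2\<close> of the lower bound for the integrand equals 1\<close>
  define b where "b = 1 - exp (- 2 :: real)"
  have b: "0 \<le> b" "b < 1" by (auto simp: b_def)
  have "((\<lambda>t. 1 / (2 * (1 - t))) has_integral (- ln (1 - b) / 2) - (- ln (1 - 0) / 2)) {0..b}"
  proof (rule fundamental_theorem_of_calculus[OF b(1)])
    fix x assume x: "x \<in> {0..b}"
    have "((\<lambda>x. - ln (1 - x) / 2) has_real_derivative 1 / (2 * (1 - x))) (at x)"
      using x b by (auto intro!: derivative_eq_intros simp: field_simps)
    thus "((\<lambda>x. - ln (1 - x) / 2) has_vector_derivative 1 / (2 * (1 - x))) (at x within {0..b})"
      by (auto simp: has_real_derivative_iff_has_vector_derivative intro: has_vector_derivative_at_within)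
  qed
  moreover have "(- ln (1 - b) / 2) - (- ln (1 - 0) / 2) = 1" by (simp add: b_def)
  ultimately have I: "((\<lambda>t. 1 / (2 * (1 - t))) has_integral 1) {0..b}" by simp
  have "1 \<le> R_int \<phi> b"
    unfolding R_int_eq
    by (rule has_integral_le[OF I integrable_integral[OF R_density_integrable]]) (use b R_density_ge in auto)
  hence "L_int \<phi> 1 \<le> R_int \<phi> b" using L_int_1_bounds by simp
  moreover have R0: "R_int \<phi> 0 = 0" by (simp add: R_int_eq)
  moreover have "continuous_on {0..b} (R_int \<phi>)"
    unfolding R_int_eq[abs_def]
    by (rule indefinite_integral_continuous_1[OF R_density_integrable]) (use b in auto)
  ultimately obtain \<rho> where \<rho>: "0 \<le> \<rho>" "\<rho> \<le> b" "R_int \<phi> \<rho> = L_int \<phi> 1"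
    using IVT'[of "R_int \<phi>" 0 "L_int \<phi> 1" b] L_int_1_bounds(1) b by auto
  have "\<rho> \<noteq> 0" using \<rho>(3) R0 L_int_1_bounds(1) by auto
  moreover have "\<rho> \<le> s" if "s \<in> {0<..<1}" "R_int \<phi> s = L_int \<phi> 1" for s
    using R_int_mono[of s \<rho>] that \<rho> b by force
  ultimately show ?thesis using \<rho> b by (intro exI[of _ \<rho>]) (auto simp: smallest_root_def)
qed

end

section \<open>The Bohr inequality\<close>

lemma partial_cauchy_product_le:
  fixes x y :: "nat \<Rightarrow> real"
  assumes "\<And>n. 0 \<le> x n" "\<And>n. 0 \<le> y n"
  shows "(\<Sum>n\<le>N. \<Sum>i\<le>n. x i * y (n - i)) \<le> (\<Sum>n\<le>N. x n) * (\<Sum>n\<le>N. y n)"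
proof -
  have "(\<Sum>n\<le>N. \<Sum>i\<le>n. x i * y (n - i)) = (\<Sum>(i,j)\<in>{(i,j). i + j \<le> N}. x i * y j)"
    by (rule sum.triangle_reindex_eq[symmetric])
  also have "\<dots> \<le> (\<Sum>(i,j)\<in>{..N} \<times> {..N}. x i * y j)"
    by (rule sum_mono2) (use assms in auto)
  also have "\<dots> = (\<Sum>n\<le>N. x n) * (\<Sum>n\<le>N. y n)"
    by (simp add: sum_product sum.cartesian_product)
  finally show ?thesis .
qed

lemma norm_coeff_mult_partial_sum_le:
  fixes F G :: "complex fps"
  assumes "0 \<le> t"
  shows "(\<Sum>n\<le>N. cmod (fps_nth (F * G) n) * t ^ n)
     \<le> (\<Sum>n\<le>N. cmod (fps_nth F n) * t ^ n) * (\<Sum>n\<le>N. cmod (fps_nth G n) * t ^ n)"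
proof -
  have "(\<Sum>n\<le>N. cmod (fps_nth (F * G) n) * t ^ n)
     \<le> (\<Sum>n\<le>N. \<Sum>i\<le>n. (cmod (fps_nth F i) * t ^ i) * (cmod (fps_nth G (n - i)) * t ^ (n - i)))"
  proof (rule sum_mono)
    fix n
    have "cmod (fps_nth (F * G) n) \<le> (\<Sum>i\<le>n. cmod (fps_nth F i) * cmod (fps_nth G (n - i)))"
      unfolding fps_mult_nth atLeast0AtMost by (rule sum_norm_le) (simp add: norm_mult)
    hence "cmod (fps_nth (F * G) n) * t ^ n \<le> (\<Sum>i\<le>n. cmod (fps_nth F i) * cmod (fps_nth G (n - i))) * t ^ n"
      by (rule mult_right_mono) (use assms in simp)
    also have "\<dots> = (\<Sum>i\<le>n. (cmod (fps_nth F i) * t ^ i) * (cmod (fps_nth G (n - i)) * t ^ (n - i)))"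
      unfolding sum_distrib_right by (rule sum.cong) (simp_all add: power_add[symmetric] mult_ac)
    finally show "cmod (fps_nth (F * G) n) * t ^ n \<le> \<dots>" .
  qed
  also have "\<dots> \<le> (\<Sum>n\<le>N. cmod (fps_nth F n) * t ^ n) * (\<Sum>n\<le>N. cmod (fps_nth G n) * t ^ n)"
    by (rule partial_cauchy_product_le) (use assms in auto)
  finally show ?thesis .
qed

text \<open>
  Termwise integration of a partial sum of the majorant series of a derivative.
\<close>

lemma antiderivative_coeff_sum_le:
  fixes a :: "nat \<Rightarrow> real"
  assumes r: "0 \<le> r" and int: "D integrable_on {0..r}"
    and le: "\<And>t. 0 \<le> t \<Longrightarrow> t \<le> r \<Longrightarrow> (\<Sum>n\<le>N. real (Suc n) * a n * t ^ n) \<le> D t"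
  shows "(\<Sum>n\<le>N. a n * r ^ Suc n) \<le> integral {0..r} D"
proof -
  have "((\<lambda>t. \<Sum>n\<le>N. real (Suc n) * a n * t ^ n) has_integral
      (\<Sum>n\<le>N. a n * r ^ Suc n) - (\<Sum>n\<le>N. a n * 0 ^ Suc n)) {0..r}"
  proof (rule fundamental_theorem_of_calculus[OF r])
    fix t :: real
    have "((\<lambda>t. \<Sum>n\<le>N. a n * t ^ Suc n) has_real_derivative (\<Sum>n\<le>N. real (Suc n) * a n * t ^ n)) (at t within {0..r})"
      by (rule DERIV_sum) (auto intro!: derivative_eq_intros simp del: power_Suc)
    thus "((\<lambda>t. \<Sum>n\<le>N. a n * t ^ Suc n) has_vector_derivative (\<Sum>n\<le>N. real (Suc n) * a n * t ^ n)) (at t within {0..r})"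
      by (simp add: has_real_derivative_iff_has_vector_derivative)
  qed
  from has_integral_le[OF this integrable_integral[OF int]] le show ?thesis by simp
qed

theorem theorem2p2:
  fixes \<phi> f :: "complex \<Rightarrow> complex"
  assumes "ma_minda \<phi>"
    and "\<And>r::real. 0 < r \<Longrightarrow> r < 1 \<Longrightarrow>
           \<phi> (- of_real r) = of_real (INF z\<in>sphere 0 r. cmod (\<phi> z))"
    and "\<And>r::real. 0 < r \<Longrightarrow> r < 1 \<Longrightarrow>
           \<phi> (of_real r) = of_real (SUP z\<in>sphere 0 r. cmod (\<phi> z))"
    and "f \<in> class_Ks \<phi>"
  shows "\<exists>r\<^sub>f. smallest_root \<phi> r\<^sub>f \<and>
           (\<forall>z. cmod z \<le> min (1 / 3) r\<^sub>f \<longrightarrow>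
              cmod z + (\<Sum>n. cmod (taylor_coeff f (n + 2)) * cmod z ^ (n + 2))
                \<le> infdist (f 0) (frontier (f ` unit_disc)))"
proof -
  have Re_pos: "0 < Re (\<phi> z)" if "z \<in> ball 0 1" for z
    using assms(1) that by (auto simp: ma_minda_def image_subset_iff)
  interpret minimal_on_negative_axis \<phi>
    by unfold_locales (use assms(1,2) Re_pos in \<open>auto simp: ma_minda_def\<close>)
  obtain E \<omega> where E: "even_starlike E" and \<omega>: "\<omega> holomorphic_on ball 0 1"
    "\<And>z. z \<in> ball 0 1 \<Longrightarrow> cmod (\<omega> z) < 1" "\<omega> 0 = 0"
    and df: "\<And>z. z \<in> ball 0 1 \<Longrightarrow> deriv f z = E z * \<phi> (\<omega> z)"
    using class_Ks_factorization[OF assms(4) \<phi>0] by metis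
  interpret E: even_starlike E by (rule E)
  have f: "f holomorphic_on ball 0 1" "taylor_coeff f 1 = 1"
    using assms(4) by (auto simp: class_Ks_def class_A_def)
  have \<omega>_in: "\<omega> z \<in> ball 0 1" if "z \<in> ball 0 1" for z using \<omega>(2)[OF that] by simp
  have inj: "inj_on f (ball 0 1)"
  proof (rule E.close_to_convex_inj[OF f(1)])
    fix z :: complex assume z: "z \<in> ball 0 1"
    have "deriv f z / E z = \<phi> (\<omega> z)" using df[OF z] E.nz[OF z] by simp
    thus "0 < Re (deriv f z / E z)" using Re_pos[OF \<omega>_in[OF z]] by simp
  qed
  \<comment> \<open>\<open>\<bar>f'\<bar> \<ge> l\<close> follows from the lower bounds for \<open>E\<close> and, with \<open>\<bar>\<omega> z\<bar> \<le> \<bar>z\<bar>\<close>, for \<open>\<phi>\<close>\<close>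
  have lower: "L_int \<phi> 1 \<le> infdist (f 0) (frontier (f ` ball 0 1))"
  proof (rule L_int_1_le)
    fix r :: real assume r: "0 \<le> r" "r < 1"
    show "L_int \<phi> r \<le> infdist (f 0) (frontier (f ` ball 0 1))"
      unfolding L_int_eq
    proof (rule covering_radius[OF f(1) inj l_cont l_pos _ r])
      fix z :: complex assume z: "z \<in> ball 0 1"
      have "cmod (\<omega> z) \<le> cmod z"
        by (rule Schwarz_Lemma(1)[OF \<omega>(1,3)]) (use \<omega>(2) z in auto)
      hence "Re (\<phi> (- of_real (cmod z))) \<le> cmod (\<phi> (\<omega> z))"
        by (intro Re_le_norm) (use z in auto)
      moreover have "0 < Re (\<phi> (- of_real (cmod z)))" by (rule Re_pos) (use z in simp)
      ultimately have "inverse (1 + (cmod z)\<^sup>2) * Re (\<phi> (- of_real (cmod z))) \<le> cmod (E z) * cmod (\<phi> (\<omega> z))"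
        by (intro mult_mono E.norm_E_ge z) auto
      thus "l (cmod z) \<le> cmod (deriv f z)"
        by (simp only: l_def df[OF z] norm_mult divide_inverse mult.commute)
    qed
  qed
  \<comment> \<open>the coefficients of \<open>f' = E \<cdot> (\<phi> \<circ> \<omega>)\<close> form a Cauchy product\<close>
  have upper: "cmod z + (\<Sum>n. cmod (taylor_coeff f (n + 2)) * cmod z ^ (n + 2)) \<le> R_int \<phi> (cmod z)"
    if z: "cmod z \<le> 1 / 3" for z
  proof -
    define r where "r = cmod z"
    have r: "0 \<le> r" "r \<le> 1/3" using z by (auto simp: r_def)
    have \<phi>\<omega>: "\<phi> \<circ> \<omega> holomorphic_on ball 0 1"
      by (rule holomorphic_on_compose_gen[OF \<omega>(1) hol]) (use \<omega>_in in blast)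
    have "(\<lambda>z. E z * (\<phi> \<circ> \<omega>) z) has_fps_expansion fps_expansion E 0 * fps_expansion (\<phi> \<circ> \<omega>) 0"
      by (intro has_fps_expansion_mult has_fps_expansion_fps_expansion[of "ball 0 1"] E.hol \<phi>\<omega>) auto
    moreover have "eventually (\<lambda>z. E z * (\<phi> \<circ> \<omega>) z = deriv f z) (nhds 0)"
      by (rule eventually_mono[OF eventually_nhds_in_open[of "ball 0 1" "0::complex"]]) (use df in auto)
    ultimately have 1: "deriv f has_fps_expansion fps_expansion E 0 * fps_expansion (\<phi> \<circ> \<omega>) 0"
      using has_fps_expansion_cong[of "\<lambda>z. E z * (\<phi> \<circ> \<omega>) z" "deriv f"] by simp
    have "deriv f has_fps_expansion fps_deriv (fps_expansion f 0)"
      by (intro has_fps_expansion_deriv has_fps_expansion_fps_expansion[of "ball 0 1"] f) auto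
    from fps_expansion_unique_complex[OF this 1]
    have coeff: "of_nat (Suc n) * taylor_coeff f (Suc n) = fps_nth (fps_expansion E 0 * fps_expansion (\<phi> \<circ> \<omega>) 0) n" for n
      by (metis fps_deriv_nth Suc_eq_plus1)
    have partial: "(\<Sum>n\<le>N. cmod (taylor_coeff f (Suc n)) * r ^ Suc n) \<le> R_int \<phi> r" for N
      unfolding R_int_eq
    proof (rule antiderivative_coeff_sum_le[OF r(1) R_density_integrable])
      fix t assume t: "0 \<le> t" "t \<le> r"
      have "(\<Sum>n\<le>N. real (Suc n) * cmod (taylor_coeff f (Suc n)) * t ^ n)
          = (\<Sum>n\<le>N. cmod (fps_nth (fps_expansion E 0 * fps_expansion (\<phi> \<circ> \<omega>) 0) n) * t ^ n)"
        by (simp only: coeff[symmetric] norm_mult norm_of_nat)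
      also have "\<dots> \<le> (\<Sum>n\<le>N. cmod (taylor_coeff E n) * t ^ n) * (\<Sum>n\<le>N. cmod (taylor_coeff (\<phi> \<circ> \<omega>) n) * t ^ n)"
        by (rule norm_coeff_mult_partial_sum_le[OF t(1)])
      also have "\<dots> \<le> 1 / (1 - t\<^sup>2) * majorant \<phi> t"
        by (intro mult_mono' E.partial_sum_le majorant_subordinate_partial_sum hol \<omega> sum_nonneg)
          (use t r in auto)
      finally show "(\<Sum>n\<le>N. real (Suc n) * cmod (taylor_coeff f (Suc n)) * t ^ n) \<le> R_density t"
        by (simp add: R_density_def)
    qed (use r in auto)
    have "(\<Sum>n. cmod (taylor_coeff f (n + 2)) * r ^ (n + 2)) \<le> R_int \<phi> r - r"
    proof (rule suminf_le_const)
      have "summable (\<lambda>n. cmod (taylor_coeff f n) * r ^ n)"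
        by (rule taylor_summable[OF f(1)]) (use r in auto)
      thus "summable (\<lambda>n. cmod (taylor_coeff f (n + 2)) * r ^ (n + 2))"
        by (subst summable_iff_shift)
      fix N
      have "(\<Sum>n\<le>N. cmod (taylor_coeff f (Suc n)) * r ^ Suc n)
          = r + (\<Sum>n<N. cmod (taylor_coeff f (n + 2)) * r ^ (n + 2))"
        unfolding sum.atMost_shift using f(2) by simp
      thus "(\<Sum>n<N. cmod (taylor_coeff f (n + 2)) * r ^ (n + 2)) \<le> R_int \<phi> r - r"
        using partial[of N] by simp
    qed
    thus ?thesis by (simp add: r_def)
  qed
  obtain \<rho> where \<rho>: "smallest_root \<phi> \<rho>" using ex_smallest_root by blast
  have "cmod z + (\<Sum>n. cmod (taylor_coeff f (n + 2)) * cmod z ^ (n + 2)) \<le> infdist (f 0) (frontier (f ` ball 0 1))"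
    if z: "cmod z \<le> min (1/3) \<rho>" for z
  proof -
    have "cmod z + (\<Sum>n. cmod (taylor_coeff f (n + 2)) * cmod z ^ (n + 2)) \<le> R_int \<phi> (cmod z)"
      by (rule upper) (use z in simp)
    also have "\<dots> \<le> R_int \<phi> \<rho>"
      using R_int_mono[of "cmod z" \<rho>] z \<rho> by (simp add: smallest_root_def)
    also have "\<dots> = L_int \<phi> 1" using \<rho> by (simp add: smallest_root_def)
    also note lower
    finally show ?thesis .
  qed
  with \<rho> show ?thesis by blast
qed

end
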